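(* Let $n$ and $k$ be integers such that $n\geqslant 2k+2$ and $k\geqslant 4$, and let $c$ and $r$ be the integers with $n=ck+r$ and $r\in\{0,\ldots,k-1\}$. Then \[\Big\lceil \big(1-\tfrac{r(c+1)}{n}\big)\cdot {\rm SP}(n,k)\Big\rceil+{\rm LL}_c\Big(\Big\lfloor \tfrac{r(c+1)}{n}\cdot {\rm SP}(n,k)\Big\rfloor\Big)\leqslant \binom{n-1}{c-1}.\]
   Context: For integers $n\geqslant k\geqslant 1$, an $(n,k)$-Sperner partition system is a collection of partitions of some $n$-element set, each into exactly $k$ nonempty classes, such that no class of any partition in the collection is a subset of a class of any other partition in the collection; ${\rm SP}(n,k)$ denotes the maximum number of partitions in such a system. For a nonnegative integer $i$ and real $y\geqslant i$, $\binom{y}{i}=\frac{1}{i!}y(y-1)\cdots(y-i+1)$. For an integer $c\geqslant 2$, the function ${\rm LL}_c:\{0\}\cup[1,\infty)\to[0,\infty)$ is defined by ${\rm LL}_c(0)=0$ and, for $x\geqslant 1$, ${\rm LL}_c(x)=\binom{q}{c-1}$ where $q$ is the unique real number with $q\geqslant c$ and $\binom{q}{c}=x$. *)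

theory Defs
  imports "HOL-Analysis.Analysis"
begin

definition sperner_partition_system :: "'a set \<Rightarrow> nat \<Rightarrow> 'a set set set \<Rightarrow> bool" where
  "sperner_partition_system X k P \<longleftrightarrow>
     (\<forall>p\<in>P. partition_on X p \<and> card p = k) \<and>
     (\<forall>p\<in>P. \<forall>q\<in>P. p \<noteq> q \<longrightarrow> (\<forall>A\<in>p. \<forall>B\<in>q. \<not> A \<subseteq> B))"

text \<open>The ground set is fixed to be \<open>{..<n}\<close>; the lemma \<open>SP_eq_Max\<close> below shows that any other
  \<open>n\<close>-element set gives the same value.\<close>

definition SP :: "nat \<Rightarrow> nat \<Rightarrow> nat" where
  "SP n k = Max {card P | P. sperner_partition_system {..<n} k P}"

text \<open>For a nonnegative integer \<open>i\<close>, \<open>y gchoose i\<close> is \<open>y (y - 1) \<dots> (y - i + 1) / i!\<close>. The function is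
  only meaningful for \<open>c \<ge> 2\<close> and \<open>x = 0 \<or> x \<ge> 1\<close>; for \<open>x \<ge> 1\<close> the definite description is
  justified by the lemma \<open>LL_root_ex1\<close> below.\<close>

definition LL :: "nat \<Rightarrow> real \<Rightarrow> real" where
  "LL c x = (if x = 0 then 0
             else (THE q::real. real c \<le> q \<and> q gchoose c = x) gchoose (c - 1))"

lemma finite_sperner_systems:
  assumes "finite X"
  shows "finite {P. sperner_partition_system X k P}"
proof (rule finite_subset)
  show "{P. sperner_partition_system X k P} \<subseteq> Pow (Pow (Pow X))"
    by (fastforce simp: sperner_partition_system_def partition_on_def)
qed (use assms in simp)

lemma finite_sperner_cards:
  assumes "finite X"
  shows "finite {card P | P. sperner_partition_system X k P}"
  using finite_imageI[OF finite_sperner_systems[OF assms], of card k]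
  by (simp add: setcompr_eq_image)

lemma SP_attained: "\<exists>P. sperner_partition_system {..<n} k P \<and> card P = SP n k"
proof -
  have "sperner_partition_system {..<n} k {}"
    by (simp add: sperner_partition_system_def)
  hence "SP n k \<in> {card P | P. sperner_partition_system {..<n} k P}"
    unfolding SP_def by (intro Max_in finite_sperner_cards) auto
  thus ?thesis by auto
qed

lemma sperner_partition_system_transport:
  assumes f: "bij_betw f X Y" and P: "sperner_partition_system X k P"
  shows "\<exists>Q. sperner_partition_system Y k Q \<and> card Q = card P"
proof -
  have inj: "inj_on f X" and im: "f ` X = Y" using f by (auto simp: bij_betw_def)
  define F where "F = (\<lambda>p. (`) f ` p)"
  have sub: "p \<in> Pow (Pow X)" if "p \<in> P" for p
    using P that by (auto simp: sperner_partition_system_def partition_on_def)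
  have inj1: "inj_on ((`) f) (Pow X)" by (rule inj_on_image_Pow[OF inj])
  have inj2: "inj_on F (Pow (Pow X))" unfolding F_def by (rule inj_on_image_Pow[OF inj1])
  have injP: "inj_on F P" by (rule inj_on_subset[OF inj2]) (use sub in blast)
  have part: "partition_on Y (F p) \<and> card (F p) = k" if p: "p \<in> P" for p
  proof
    have pp: "partition_on X p" "card p = k"
      using P p by (auto simp: sperner_partition_system_def)
    have ps: "p \<subseteq> Pow X" using sub[OF p] by simp
    show "card (F p) = k"
      unfolding F_def using card_image[OF inj_on_subset[OF inj1 ps]] pp(2) by simp
    show "partition_on Y (F p)"
    proof (rule partition_onI)
      show "\<Union> (F p) = Y" using pp(1) im by (auto simp: F_def partition_on_def)
      show "{} \<notin> F p"
        using pp(1) by (auto simp: F_def partition_on_def)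
      show "disjnt A B" if AB: "A \<in> F p" "B \<in> F p" "A \<noteq> B" for A B
      proof -
        obtain A' B' where h: "A' \<in> p" "B' \<in> p" "A = f ` A'" "B = f ` B'"
          using AB by (auto simp: F_def)
        with AB(3) have "A' \<noteq> B'" by auto
        hence "A' \<inter> B' = {}"
          using pp(1) h by (auto simp: partition_on_def disjoint_def)
        moreover have "A' \<subseteq> X" "B' \<subseteq> X" using h ps by auto
        ultimately have "A \<inter> B = {}"
          using h inj_on_image_Int[OF inj, of A' B'] by simp
        thus ?thesis by (simp add: disjnt_def)
      qed
    qed
  qed
  have "sperner_partition_system Y k (F ` P)"
    unfolding sperner_partition_system_def
  proof (intro conjI ballI impI)
    fix p q A B assume h: "p \<in> F ` P" "q \<in> F ` P" "p \<noteq> q" "A \<in> p" "B \<in> q"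
    obtain p' q' where pq: "p' \<in> P" "q' \<in> P" "p = F p'" "q = F q'" using h by auto
    obtain A' B' where AB: "A' \<in> p'" "B' \<in> q'" "A = f ` A'" "B = f ` B'"
      using h pq by (auto simp: F_def)
    have "A' \<subseteq> X" "B' \<subseteq> X" using AB sub pq by auto
    moreover have "p' \<noteq> q'" using h(3) pq by auto
    hence "\<not> A' \<subseteq> B'"
      using P pq(1,2) AB(1,2) unfolding sperner_partition_system_def by blast
    ultimately show "\<not> A \<subseteq> B"
      using inj AB by (simp add: inj_on_image_subset_iff)
  qed (use part in auto)
  thus ?thesis using card_image[OF injP] by blast
qed

lemma SP_eq_Max:
  assumes "finite X" "card X = n"
  shows "SP n k = Max {card P | P. sperner_partition_system X k P}"
proof -
  obtain f where f: "bij_betw f X {..<n}"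
    using finite_same_card_bij[of X "{..<n}"] assms by auto
  obtain g where g: "bij_betw g {..<n} X"
    using bij_betw_inv[OF f] by auto
  have "{card P | P. sperner_partition_system {..<n} k P} =
        {card P | P. sperner_partition_system X k P}"
    using sperner_partition_system_transport[OF f]
      sperner_partition_system_transport[OF g]
    by (fastforce intro: sym)
  thus ?thesis by (simp add: SP_def)
qed

lemma LL_root_ex1:
  assumes c: "c \<ge> 1" and x: "(x::real) \<ge> 1"
  shows "\<exists>!q::real. real c \<le> q \<and> q gchoose c = x"
proof -
  have mono: "(a gchoose c) < (b gchoose c)" if "real c \<le> a" "a < b" for a b :: real
  proof -
    have "(\<Prod>i<c. a - real i) < (\<Prod>i<c. b - real i)"
      by (rule prod_mono_strict[of 0]) (use c that in auto)
    thus ?thesis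
      by (simp add: gbinomial_prod_rev atLeast0LessThan divide_strict_right_mono)
  qed
  have cont: "continuous_on S (\<lambda>q::real. q gchoose c)" for S
    unfolding gbinomial_prod_rev by (intro continuous_intros) auto
  have lo: "(real c gchoose c) \<le> x"
    using x by (simp flip: binomial_gbinomial)
  have hi: "x \<le> ((real c + x * fact c) gchoose c)"
  proof -
    let ?b = "real c + x * fact c"
    have f: "1 \<le> x * (fact c :: real)"
      using mult_mono[OF x fact_ge_1[of c]] x by simp
    have "x * fact c \<le> ?b - real 0" by simp
    also have "\<dots> = (\<Prod>i\<in>{0}. ?b - real i)" by simp
    also have "\<dots> \<le> (\<Prod>i<c. ?b - real i)"
    proof (rule prod_mono2)
      fix i assume "i \<in> {..<c} - {0}"
      hence "real i \<le> real c" by simp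
      thus "1 \<le> ?b - real i" using f by linarith
    qed (use c f in auto)
    finally show ?thesis
      by (simp add: gbinomial_prod_rev atLeast0LessThan field_simps)
  qed
  obtain q where q: "real c \<le> q" "q gchoose c = x"
    using IVT'[of "\<lambda>q. q gchoose c" "real c" x "real c + x * fact c"] lo hi x cont by auto
  show ?thesis
  proof (rule ex1I[of _ q])
    fix y assume "real c \<le> y \<and> y gchoose c = x"
    thus "y = q" using mono[of y q] mono[of q y] q by (cases y q rule: linorder_cases) auto
  qed (use q in simp)
qed

end

theory Submission
  imports Defs
begin

text \<open>Let \<open>p\<close> be the number of partitions of an optimal system. Each of them contributes \<open>k\<close> to the sum
  over all points \<open>x\<close> of \<open>1 / \<bar>A\<bar>\<close>, \<open>A\<close> the class of \<open>x\<close>, so some point \<open>x\<close> has reciprocal class sizes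
  adding up to at least \<open>k p / n\<close>. Deleting \<open>x\<close> from its classes leaves an antichain of \<open>p\<close> sets on
  \<open>n - 1\<close> points. For the weight \<open>wt c i\<close>, an affine function of \<open>1 / (i + 1)\<close> with value 1 at
  \<open>i = c - 1\<close> and 0 at \<open>i = c\<close>, its total weight is at least \<open>(1 - r (c + 1) / n) p\<close>. Sets with fewer
  than \<open>c - 1\<close> points can be replaced by supersets without losing count or weight. Sets with more than
  \<open>c\<close> points are pushed down level by level to size \<open>c\<close>; by Lovasz's form of the Kruskal--Katona theorem
  this may lose count only when there are already so many \<open>c\<close>-sets that the slope of \<open>LL c\<close> is small, and
  then the negative weight that disappears pays for the loss. If \<open>u\<close> sets of size \<open>c - 1\<close> and \<open>v\<close> of size
  \<open>c\<close> remain, the shadow of the latter is disjoint from the former, so \<open>u + LL c v \<le> (n - 1 choose c - 1)\<close>.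
  The case \<open>0 < a < (2 c - 1 choose c)\<close>, where \<open>a\<close> is the argument of \<open>LL c\<close> and its slope may exceed 1, is
  settled by the smallness of \<open>p\<close>.\<close>

section \<open>Binomial coefficients with a real upper argument\<close>

lemma gchoose_Suc_mult:
  fixes x :: real
  shows "real (Suc k) * (x gchoose Suc k) = (x - real k) * (x gchoose k)"
proof -
  have "fact (Suc k) * (x gchoose Suc k) = (x - real k) * (fact k * (x gchoose k))"
    by (simp only: gbinomial_prod_rev atLeast0LessThan prod.lessThan_Suc) simp
  thus ?thesis by (simp add: fact_Suc del: of_nat_Suc)
qed

text \<open>The hypothesis \<open>real k \<le> a + 1\<close> keeps the smallest factor
  \<open>a - (k - 1)\<close> nonnegative, so the products can be compared factor by factor.\<close>

lemma gchoose_mono: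
  fixes a b :: real
  assumes "real k \<le> a + 1" "a \<le> b"
  shows "a gchoose k \<le> b gchoose k"
proof -
  have "(\<Prod>i<k. a - real i) \<le> (\<Prod>i<k. b - real i)"
    by (rule prod_mono) (use assms in auto)
  thus ?thesis
    by (simp add: gbinomial_prod_rev atLeast0LessThan divide_right_mono)
qed

lemma gchoose_strict_mono:
  fixes a b :: real
  assumes "k \<ge> 1" "real k \<le> a + 1" "a < b"
  shows "a gchoose k < b gchoose k"
proof -
  have "(\<Prod>i<k. a - real i) < (\<Prod>i<k. b - real i)"
    by (rule prod_mono_strict[of 0]) (use assms in auto)
  thus ?thesis
    by (simp add: gbinomial_prod_rev atLeast0LessThan divide_strict_right_mono)
qed

text \<open>Contraposition of monotonicity: only \<open>b\<close>, the lower argument if the claim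
  fails, needs a lower bound.\<close>

lemma gchoose_less_cancel:
  fixes a b :: real
  assumes "k \<ge> 1" "real k \<le> b + 1" "a gchoose k < b gchoose k"
  shows "a < b"
  using gchoose_mono[of k b a] assms by linarith

lemma gchoose_le_cancel:
  fixes a b :: real
  assumes "k \<ge> 1" "real k \<le> b + 1" "a gchoose k \<le> b gchoose k"
  shows "a \<le> b"
  using gchoose_strict_mono[of k b a] assms by linarith

lemma gchoose_ge_1:
  fixes a :: real
  assumes "real k \<le> a"
  shows "1 \<le> a gchoose k"
  using gchoose_mono[of k "real k" a] assms by (simp flip: binomial_gbinomial)

section \<open>Lovasz's form of the Kruskal--Katona theorem\<close>

lemma sum_card_containing:
  assumes "finite V" "finite F" "\<And>A. A \<in> F \<Longrightarrow> A \<subseteq> V"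
  shows "(\<Sum>v\<in>V. card {A\<in>F. v \<in> A}) = (\<Sum>A\<in>F. card A)"
proof -
  have "(\<Sum>v\<in>V. card {A\<in>F. v \<in> A}) = (\<Sum>A\<in>F. card {v\<in>V. v \<in> A})"
    using sum.swap_restrict[OF assms(1,2), of "\<lambda>_ _. 1::nat" "\<lambda>v A. v \<in> A"] by simp
  also have "\<dots> = (\<Sum>A\<in>F. card A)"
    by (intro sum.cong refl arg_cong[of _ _ card]) (use assms(3) in auto)
  finally show ?thesis .
qed

lemma inj_on_remove: "(\<And>A. A \<in> F \<Longrightarrow> v \<in> A) \<Longrightarrow> inj_on (\<lambda>A. A - {v}) F"
  by (rule inj_onI) (metis insert_Diff)

text \<open>Induction on \<open>r\<close> via links of vertices (Keevash): the cliques through \<open>v\<close> number at most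
  \<open>(x - r) / r\<close> times the degree of \<open>v\<close>. For small degree this is the induction hypothesis for the
  link; for large degree it suffices that removing \<open>v\<close> from a clique leaves an edge avoiding \<open>v\<close>.\<close>

lemma card_cliques_le:
  fixes x :: real
  assumes "r \<ge> 1" "finite V"
    and "\<And>A. A \<in> G \<Longrightarrow> A \<subseteq> V \<and> card A = r"
    and "\<And>A. A \<in> K \<Longrightarrow> A \<subseteq> V \<and> card A = Suc r"
    and "\<And>A v. A \<in> K \<Longrightarrow> v \<in> A \<Longrightarrow> A - {v} \<in> G"
    and "real (card G) \<le> x gchoose r" "real r \<le> x"
  shows "real (card K) \<le> x gchoose Suc r"
  using assms
proof (induction r arbitrary: G K x)
  case (Suc s)
  define r where "r = Suc s"
  note G = Suc.prems(3)[folded r_def] and K = Suc.prems(4)[folded r_def]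
    and KG = Suc.prems(5) and x = Suc.prems(6,7)[folded r_def] and V = Suc.prems(2)
  have finG: "finite G" and finK: "finite K"
    by (rule finite_subset[of _ "Pow V"]; use G K V in auto)+
  have local_bound: "real r * card {A\<in>K. v \<in> A} \<le> (x - r) * card {A\<in>G. v \<in> A}" for v
  proof -
    define Gv Kv where "Gv = {A\<in>G. v \<in> A}" and "Kv = {A\<in>K. v \<in> A}"
    define G' K' where "G' = (\<lambda>A. A - {v}) ` Gv" and "K' = (\<lambda>A. A - {v}) ` Kv"
    have cG': "card G' = card Gv" and cK': "card K' = card Kv"
      unfolding G'_def K'_def Gv_def Kv_def by (auto intro!: card_image inj_on_remove)
    have fGv: "finite Gv" using finG by (simp add: Gv_def)
    have "card Kv + card Gv = card (K' \<union> Gv)"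
      using cK' finG finK by (subst card_Un_disjoint) (auto simp: K'_def Gv_def Kv_def)
    also have "\<dots> \<le> card G"
      using KG finG by (intro card_mono) (auto simp: K'_def Gv_def Kv_def)
    finally have c1: "card Kv + card Gv \<le> card G" .
    have "real r * card Kv \<le> (x - r) * card Gv"
    \<comment> \<open>For integral \<open>x\<close> the threshold is the degree of a vertex when all
      \<open>r\<close>-subsets of \<open>x\<close> points are edges. From there on \<open>c1\<close>
      suffices.\<close>
    proof (cases "x - 1 gchoose s \<le> real (card Gv)")
      case True
      have "real r * card Kv \<le> real r * (x gchoose r) - real r * card Gv"
        using c1 x(1) by (simp add: right_diff_distrib[symmetric] mult_left_mono)
      also have "real r * (x gchoose r) = x * (x - 1 gchoose s)"
        using gbinomial_absorption[of s x] by (simp add: r_def)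
      also have "\<dots> \<le> x * card Gv"
        using True x(2) by (intro mult_left_mono) auto
      finally show ?thesis by (simp add: algebra_simps)
    next
      case False
      show ?thesis
      \<comment> \<open>Degree 0 has no root \<open>y\<close> and is treated apart: a clique through
        \<open>v\<close> has a second vertex \<open>w\<close>, and deleting \<open>w\<close> leaves
        an edge through \<open>v\<close>.\<close>
      proof (cases "card Gv = 0")
        case True
        hence "Gv = {}" using fGv by simp
        have "Kv = {}"
        proof (rule ccontr)
          assume "Kv \<noteq> {}"
          then obtain A where A: "A \<in> K" "v \<in> A" by (auto simp: Kv_def)
          have "card (A - {v}) = r" using K[OF A(1)] A(2) by simp
          hence "A - {v} \<noteq> {}" unfolding r_def by force
          then obtain w where w: "w \<in> A" "w \<noteq> v" by auto
          have "A - {w} \<in> Gv" using KG[OF A(1) w(1)] A w by (auto simp: Gv_def)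
          thus False using \<open>Gv = {}\<close> by simp
        qed
        thus ?thesis using True by simp
      next
        case nz: False
        \<comment> \<open>For \<open>s = 0\<close> the threshold is 1, which a nonzero degree
          reaches.\<close>
        have s1: "s \<ge> 1" using False nz by (cases s) auto
        obtain y where y: "real s \<le> y" "y gchoose s = real (card Gv)"
          using LL_root_ex1[OF s1, of "real (card Gv)"] nz by auto
        have yx: "y < x - 1"
          by (rule gchoose_less_cancel[OF s1]) (use False y x(2) in \<open>auto simp: r_def\<close>)
        have "real (card K') \<le> y gchoose Suc s"
        proof (rule Suc.IH[OF s1 V])
          show "A \<subseteq> V \<and> card A = s" if "A \<in> G'" for A
            using that G V by (auto simp: G'_def Gv_def r_def)
          show "A \<subseteq> V \<and> card A = Suc s" if "A \<in> K'" for A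
            using that K V by (auto simp: K'_def Kv_def r_def)
          show "A - {w} \<in> G'" if Aw: "A \<in> K'" "w \<in> A" for A w
          proof -
            obtain A0 where A0: "A0 \<in> K" "v \<in> A0" "A = A0 - {v}"
              using Aw by (auto simp: K'_def Kv_def)
            have "A0 - {w} \<in> Gv" using Aw A0 KG[of A0 w] by (auto simp: Gv_def)
            moreover have "A - {w} = (A0 - {w}) - {v}" using A0 by auto
            ultimately show ?thesis by (auto simp: G'_def)
          qed
        qed (use y cG' in auto)
        hence "real r * card Kv \<le> real r * (y gchoose r)"
          unfolding cK' r_def by (intro mult_left_mono) auto
        also have "\<dots> = (y - s) * card Gv"
          using gchoose_Suc_mult[of s y] y by (simp add: r_def)
        also have "\<dots> \<le> (x - r) * card Gv"
          using yx by (intro mult_right_mono) (auto simp: r_def)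
        finally show ?thesis .
      qed
    qed
    thus ?thesis by (simp add: Gv_def Kv_def)
  qed
  \<comment> \<open>Summed over all \<open>v\<close>, the local bound counts each clique
    \<open>Suc r\<close> times and each edge \<open>r\<close> times.\<close>
  have "real r * (real (Suc r) * card K) = (\<Sum>v\<in>V. real r * card {A\<in>K. v \<in> A})"
    unfolding sum_distrib_left[symmetric] of_nat_sum[symmetric]
    by (subst sum_card_containing[OF V finK]) (use K in \<open>auto simp: algebra_simps\<close>)
  also have "\<dots> \<le> (\<Sum>v\<in>V. (x - r) * card {A\<in>G. v \<in> A})"
    by (intro sum_mono local_bound)
  also have "\<dots> = (x - r) * (real r * card G)"
    unfolding sum_distrib_left[symmetric] of_nat_sum[symmetric]
    by (subst sum_card_containing[OF V finG]) (use G in auto)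
  also have "\<dots> \<le> (x - r) * (real r * (x gchoose r))"
    using x by (intro mult_left_mono) auto
  also have "\<dots> = real r * (real (Suc r) * (x gchoose Suc r))"
    by (simp only: gchoose_Suc_mult) simp
  finally have "real (Suc r) * card K \<le> real (Suc r) * (x gchoose Suc r)"
    by (simp add: r_def)
  thus ?case by (simp only: mult_le_cancel_left_pos of_nat_0_less_iff r_def zero_less_Suc)
qed simp

text \<open>The conjunct \<open>finite A\<close> matters for \<open>j = 0\<close>: infinite sets
  also have \<open>card\<close> 0.\<close>

definition lower_shadow :: "nat \<Rightarrow> 'a set set \<Rightarrow> 'a set set" where
  "lower_shadow j F = {A. card A = j \<and> finite A \<and> (\<exists>B\<in>F. A \<subseteq> B)}"

lemma finite_lower_shadow:
  "finite F \<Longrightarrow> (\<And>A. A \<in> F \<Longrightarrow> finite A) \<Longrightarrow> finite (lower_shadow j F)"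
  by (rule finite_subset[of "lower_shadow j F" "Pow (\<Union>F)"])
    (unfold lower_shadow_def, blast, simp)

lemma lower_shadow_mono: "F \<subseteq> G \<Longrightarrow> lower_shadow j F \<subseteq> lower_shadow j G"
  by (auto simp: lower_shadow_def)

lemma lower_shadow_lower_shadow_subset:
  "lower_shadow i (lower_shadow j F) \<subseteq> lower_shadow i F"
  unfolding lower_shadow_def by blast

text \<open>The sets of \<open>F\<close> are cliques over their shadow. If the shadow were too
  small, its root \<open>x\<close> would lie below \<open>y\<close>, and
  \<open>card_cliques_le\<close> would allow fewer than \<open>y gchoose Suc t\<close>
  cliques.\<close>

lemma lovasz_shadow_Suc:
  fixes y :: real
  assumes "finite F" "\<And>A. A \<in> F \<Longrightarrow> card A = Suc t"
    and y: "real (Suc t) \<le> y" "y gchoose Suc t \<le> real (card F)"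
  shows "y gchoose t \<le> real (card (lower_shadow t F))"
proof -
  have fin: "finite A" if "A \<in> F" for A using assms(2)[OF that] card.infinite by fastforce
  note finS = finite_lower_shadow[OF assms(1) fin, of t]
  have "1 \<le> real (card F)" using gchoose_ge_1[OF y(1)] y(2) by simp
  then obtain A0 where A0: "A0 \<in> F" using assms(1) by fastforce
  have "A0 \<noteq> {}" using assms(2)[OF A0] by auto
  then obtain v0 where "v0 \<in> A0" by auto
  have sub: "A - {v} \<in> lower_shadow t F" if "A \<in> F" "v \<in> A" for A v
    using that fin assms(2) by (auto simp: lower_shadow_def)
  have c1: "real (card (lower_shadow t F)) \<ge> 1"
    using sub[OF A0 \<open>v0 \<in> A0\<close>] finS by (cases "card (lower_shadow t F)") auto
  show ?thesis
  proof (cases "t = 0")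
    case True thus ?thesis using c1 by simp
  next
    case False
    hence t1: "t \<ge> 1" by simp
    show ?thesis
    proof (rule ccontr)
      assume less: "\<not> ?thesis"
      obtain x where x: "real t \<le> x" "x gchoose t = real (card (lower_shadow t F))"
        using LL_root_ex1[OF t1 c1] by auto
      have xy: "x < y"
        by (rule gchoose_less_cancel[OF t1]) (use less x y in auto)
      have "real (card F) \<le> x gchoose Suc t"
        by (rule card_cliques_le[OF t1, of "\<Union>F" "lower_shadow t F"])
          (use assms(1,2) fin sub x in \<open>auto simp: lower_shadow_def\<close>)
      also have "\<dots> < y gchoose Suc t"
        by (rule gchoose_strict_mono) (use x xy in auto)
      finally show False using y by simp
    qed
  qed
qed

text \<open>The one-level bound is iterated. Its conclusion has the form of its hypothesis with the
  same \<open>y\<close>, so no new root is taken on the way down.\<close>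

lemma lovasz_shadow:
  fixes y :: real
  assumes "finite F" "\<And>A. A \<in> F \<Longrightarrow> finite A \<and> card A = t"
    and "real t \<le> y" "y gchoose t \<le> real (card F)" "j \<le> t"
  shows "y gchoose j \<le> real (card (lower_shadow j F))"
  using assms
proof (induction t arbitrary: F)
  case 0
  hence "F \<subseteq> lower_shadow 0 F" by (auto simp: lower_shadow_def)
  hence "card F \<le> card (lower_shadow 0 F)"
    using 0 by (intro card_mono finite_lower_shadow) auto
  with 0 show ?case by simp
next
  case (Suc t)
  show ?case
  proof (cases "j = Suc t")
    case True
    hence "F \<subseteq> lower_shadow j F" using Suc.prems by (auto simp: lower_shadow_def)
    hence "card F \<le> card (lower_shadow j F)"
      using Suc.prems by (intro card_mono finite_lower_shadow) auto
    with Suc.prems True show ?thesis by simp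
  next
    case False
    have "y gchoose j \<le> card (lower_shadow j (lower_shadow t F))"
    proof (rule Suc.IH)
      show "finite (lower_shadow t F)"
        using Suc.prems by (intro finite_lower_shadow) auto
      show "y gchoose t \<le> card (lower_shadow t F)"
        using Suc.prems by (intro lovasz_shadow_Suc) auto
    qed (use Suc.prems False in \<open>auto simp: lower_shadow_def\<close>)
    also have "\<dots> \<le> card (lower_shadow j F)"
      unfolding of_nat_le_iff
      by (intro card_mono lower_shadow_lower_shadow_subset finite_lower_shadow)
        (use Suc.prems in auto)
    finally show ?thesis .
  qed
qed

section \<open>Antichains and the lifting of small sets\<close>

definition antichain :: "'a set set \<Rightarrow> bool" where
  "antichain F \<longleftrightarrow> (\<forall>A\<in>F. \<forall>B\<in>F. A \<subseteq> B \<longrightarrow> A = B)"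

lemma antichainD: "antichain F \<Longrightarrow> A \<in> F \<Longrightarrow> B \<in> F \<Longrightarrow> A \<subseteq> B \<Longrightarrow> A = B"
  by (auto simp: antichain_def)

definition upper_shadow :: "'a set \<Rightarrow> nat \<Rightarrow> 'a set set \<Rightarrow> 'a set set" where
  "upper_shadow X j F = {B. B \<subseteq> X \<and> card B = j \<and> (\<exists>A\<in>F. A \<subseteq> B)}"

text \<open>Double counting of inclusions: every \<open>A\<close> has \<open>card X - m\<close>
  extensions by one point, and every \<open>B\<close> contains at most \<open>Suc m\<close> members
  of \<open>F\<close>.\<close>

lemma card_upper_shadow_ge:
  assumes X: "finite X" and F: "\<And>A. A \<in> F \<Longrightarrow> A \<subseteq> X \<and> card A = m"
  shows "card F * (card X - m) \<le> card (upper_shadow X (Suc m) F) * Suc m"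
proof -
  let ?U = "upper_shadow X (Suc m) F"
  have finF: "finite F" by (rule finite_subset[of _ "Pow X"]) (use F X in auto)
  have finU: "finite ?U"
    by (rule finite_subset[of _ "Pow X"]) (use X in \<open>auto simp: upper_shadow_def\<close>)
  have up: "card X - m \<le> card {B\<in>?U. A \<subseteq> B}" if A: "A \<in> F" for A
  proof -
    have fA: "finite A" using F[OF A] X finite_subset by blast
    have inj: "inj_on (\<lambda>x. insert x A) (X - A)" by (rule inj_onI) blast
    have "card X - m = card (X - A)"
      using F[OF A] fA by (simp add: card_Diff_subset)
    also have "\<dots> = card ((\<lambda>x. insert x A) ` (X - A))"
      using card_image[OF inj] by simp
    also have "\<dots> \<le> card {B\<in>?U. A \<subseteq> B}"
    proof (rule card_mono)
      show "finite {B\<in>?U. A \<subseteq> B}" using finU by simp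
    qed (use F[OF A] fA A in \<open>auto simp: upper_shadow_def\<close>)
    finally show ?thesis .
  qed
  have down: "card {A\<in>F. A \<subseteq> B} \<le> Suc m" if B: "B \<in> ?U" for B
  proof -
    have fB: "finite B" and cB: "card B = Suc m"
      using B finite_subset[OF _ X, of B] by (auto simp: upper_shadow_def)
    have "card {A\<in>F. A \<subseteq> B} \<le> card {A. A \<subseteq> B \<and> card A = m}"
      by (rule card_mono) (use F fB in auto)
    thus ?thesis using n_subsets[OF fB, of m] cB by simp
  qed
  have "card F * (card X - m) = (\<Sum>A\<in>F. card X - m)" by simp
  also have "\<dots> \<le> (\<Sum>A\<in>F. card {B\<in>?U. A \<subseteq> B})"
    by (rule sum_mono) (rule up)
  also have "\<dots> = (\<Sum>B\<in>?U. card {A\<in>F. A \<subseteq> B})"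
    using sum.swap_restrict[OF finF finU, of "\<lambda>_ _. 1::nat" "\<lambda>A B. A \<subseteq> B"] by simp
  also have "\<dots> \<le> (\<Sum>B\<in>?U. Suc m)"
    by (rule sum_mono) (rule down)
  finally show ?thesis by simp
qed

text \<open>Equal to \<open>c * (c - i) / (i + 1)\<close>. A set of size \<open>i\<close> arises
  from a class of size \<open>i + 1\<close>, so a total of these weights is governed by the sum of
  reciprocal class sizes.\<close>

definition wt :: "nat \<Rightarrow> nat \<Rightarrow> real" where
  "wt c i = real c * (real c + 1) / (real i + 1) - real c"

text \<open>Passing to size \<open>Suc m\<close> lowers the weight per set but multiplies the count
  by at least \<open>(N - m) / (m + 1)\<close>. This pays because
  \<open>c - m \<le> 2 * (c - m - 1)\<close> and \<open>2 * (m + 2) \<le> N - m\<close>.\<close>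

lemma wt_lift:
  fixes f g :: real
  assumes "Suc (Suc m) \<le> c" "3 * c \<le> N" and f: "0 \<le> f"
    and fg: "f * (real N - real m) \<le> g * real (Suc m)"
  shows "f \<le> g" "f * wt c m \<le> g * wt c (Suc m)"
proof -
  have g0: "g \<ge> f * (real N - real m) / (real m + 1)"
    using fg by (simp add: pos_divide_le_eq add.commute)
  have "f * (real m + 1) \<le> f * (real N - real m)"
    using assms(1,2) f by (intro mult_left_mono) auto
  also note fg
  finally have "f * real (Suc m) \<le> g * real (Suc m)" by (simp add: add.commute)
  thus "f \<le> g" by (simp only: mult_le_cancel_right_pos of_nat_0_less_iff zero_less_Suc)
  have "wt c (Suc m) = real c * (real c - real m - 1) / (real m + 2)"
    by (simp add: wt_def field_simps)
  moreover have "real c * (real c - real m - 1) / (real m + 2) \<ge> 0"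
    using assms(1) by (intro divide_nonneg_pos mult_nonneg_nonneg) auto
  ultimately have w: "wt c (Suc m) = real c * (real c - real m - 1) / (real m + 2)"
      "wt c (Suc m) \<ge> 0" by auto
  have "(real c - real m) * (real m + 2) \<le> (2 * (real c - real m - 1)) * (real m + 2)"
    using assms(1) by (intro mult_right_mono) auto
  also have "\<dots> = (real c - real m - 1) * (2 * (real m + 2))" by (simp add: algebra_simps)
  also have "\<dots> \<le> (real c - real m - 1) * (real N - real m)"
    using assms(1,2) by (intro mult_left_mono) auto
  finally have key: "(real c - real m) * (real m + 2) \<le> (real c - real m - 1) * (real N - real m)" .
  have "wt c m = real c * (real c - real m) / (real m + 1)"
    by (simp add: wt_def field_simps)
  also have "\<dots> = real c * ((real c - real m) * (real m + 2)) / ((real m + 1) * (real m + 2))"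
    by simp
  also have "\<dots> \<le> real c * ((real c - real m - 1) * (real N - real m)) / ((real m + 1) * (real m + 2))"
    using key by (intro divide_right_mono mult_left_mono) auto
  also have "\<dots> = (real N - real m) / (real m + 1) * wt c (Suc m)"
    by (simp add: w(1))
  finally have "f * wt c m \<le> f * ((real N - real m) / (real m + 1) * wt c (Suc m))"
    using f by (intro mult_left_mono)
  also have "\<dots> = f * (real N - real m) / (real m + 1) * wt c (Suc m)" by simp
  also have "\<dots> \<le> g * wt c (Suc m)"
    using g0 w(2) by (intro mult_right_mono)
  finally show "f * wt c m \<le> g * wt c (Suc m)" .
qed

text \<open>Each round replaces all sets of the minimal size \<open>m\<close> by their full upper
  shadow, until size \<open>c - 1\<close> is reached.\<close>

lemma antichain_lift:
  assumes "finite X" "3 * c \<le> card X" "antichain F" "F \<subseteq> Pow X"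
    and "\<And>A. A \<in> F \<Longrightarrow> m \<le> card A"
  shows "\<exists>F'. antichain F' \<and> F' \<subseteq> Pow X \<and> (\<forall>A\<in>F'. c \<le> Suc (card A)) \<and>
          card F \<le> card F' \<and> (\<Sum>A\<in>F. wt c (card A)) \<le> (\<Sum>A\<in>F'. wt c (card A))"
  using assms
proof (induction "c - m" arbitrary: m F rule: less_induct)
  case less
  note X = less.prems(1,2) and anti = less.prems(3) and FX = less.prems(4) and m = less.prems(5)
  show ?case
  proof (cases "c \<le> Suc m")
    case True
    have "c \<le> Suc (card A)" if "A \<in> F" for A using m[OF that] True by linarith
    thus ?thesis using anti FX by (intro exI[of _ F]) simp
  next
    case False
    hence mc: "Suc (Suc m) \<le> c" by simp
    define T where "T = {A\<in>F. card A = m}"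
    define U where "U = upper_shadow X (Suc m) T"
    define F1 where "F1 = (F - T) \<union> U"
    have finF: "finite F" using finite_subset[OF FX] X by simp
    have finT: "finite T" using finF by (simp add: T_def)
    have finU: "finite U"
      by (rule finite_subset[of _ "Pow X"]) (use X in \<open>auto simp: upper_shadow_def U_def\<close>)
    have TF: "T \<subseteq> F" by (auto simp: T_def)
    have fin: "finite A" if "A \<in> F \<union> U" for A
      using that FX finite_subset[OF _ X(1), of A] by (auto simp: U_def upper_shadow_def)
    have UE: "\<exists>A\<in>F. A \<subseteq> B \<and> card A = m" if "B \<in> U" for B
      using that by (auto simp: U_def upper_shadow_def T_def)
    have cU: "card B = Suc m" if "B \<in> U" for B
      using that by (auto simp: U_def upper_shadow_def)
    have cF: "Suc m \<le> card A" if "A \<in> F - T" for A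
      using m[of A] that by (auto simp: T_def)
    \<comment> \<open>A new set inside an old one would put a set of \<open>T\<close> inside it.
      Equality is included, which also yields \<open>disj\<close>.\<close>
    have no: False if AB: "A \<in> U" "B \<in> F - T" "A \<subseteq> B" for A B
    proof -
      obtain A0 where A0: "A0 \<in> F" "A0 \<subseteq> A" "card A0 = m" using UE[OF AB(1)] by auto
      have "A0 = B" using antichainD[OF anti A0(1), of B] AB A0 by auto
      thus False using cF[OF AB(2)] A0 by simp
    qed
    have anti1: "antichain F1"
      unfolding antichain_def
    proof (intro ballI impI)
      fix A B assume AB: "A \<in> F1" "B \<in> F1" "A \<subseteq> B"
      have fB: "finite B" using AB fin by (auto simp: F1_def)
      show "A = B"
      proof (cases "B \<in> U")
        case True
        have "card B \<le> card A" using AB cU[OF True] cU[of A] cF[of A] by (auto simp: F1_def)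
        thus ?thesis using card_seteq[OF fB AB(3)] by simp
      next
        case False
        hence "B \<in> F - T" using AB by (auto simp: F1_def)
        hence "A \<in> F - T" using no AB by (auto simp: F1_def)
        thus ?thesis using antichainD[OF anti] AB \<open>B \<in> F - T\<close> by auto
      qed
    qed
    have disj: "(F - T) \<inter> U = {}" using no by blast
    have count: "card T * (card X - m) \<le> card U * Suc m"
      unfolding U_def by (rule card_upper_shadow_ge) (use X FX in \<open>auto simp: T_def\<close>)
    have "real (card X) - real m = real (card X - m)" using mc X by simp
    hence cnt: "real (card T) * (real (card X) - real m) \<le> real (card U) * real (Suc m)"
      using count by (metis of_nat_le_iff of_nat_mult)
    note lift = wt_lift[OF mc X(2) _ cnt]
    have cFeq: "card F = card (F - T) + card T"
      using card_Diff_subset[OF finT TF] card_mono[OF finF TF] by simp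
    have "card F1 = card (F - T) + card U"
      unfolding F1_def using finF finU disj by (intro card_Un_disjoint) auto
    hence c1: "card F \<le> card F1" using lift(1) cFeq by simp
    have "(\<Sum>A\<in>F. wt c (card A)) = (\<Sum>A\<in>F - T. wt c (card A)) + (\<Sum>A\<in>T. wt c (card A))"
      using TF finF by (rule sum.subset_diff)
    also have "(\<Sum>A\<in>T. wt c (card A)) = card T * wt c m" by (simp add: T_def)
    also have "\<dots> \<le> card U * wt c (Suc m)" using lift(2) by simp
    also have "\<dots> = (\<Sum>A\<in>U. wt c (card A))" using cU by simp
    also have "(\<Sum>A\<in>F - T. wt c (card A)) + \<dots> = (\<Sum>A\<in>F1. wt c (card A))"
      unfolding F1_def using finF finU disj by (intro sum.union_disjoint[symmetric]) auto
    finally have w1: "(\<Sum>A\<in>F. wt c (card A)) \<le> (\<Sum>A\<in>F1. wt c (card A))" by simp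
    have F1X: "F1 \<subseteq> Pow X" using FX by (auto simp: F1_def U_def upper_shadow_def)
    have m1: "Suc m \<le> card A" if "A \<in> F1" for A
      using that cU cF by (auto simp: F1_def)
    have "c - Suc m < c - m" using mc by simp
    have "\<exists>F'. antichain F' \<and> F' \<subseteq> Pow X \<and> (\<forall>A\<in>F'. c \<le> Suc (card A)) \<and>
        card F1 \<le> card F' \<and> (\<Sum>A\<in>F1. wt c (card A)) \<le> (\<Sum>A\<in>F'. wt c (card A))"
      using m1 by (intro less.hyps[of "Suc m"] X anti1 F1X \<open>c - Suc m < c - m\<close>)
    then obtain F' where "antichain F'" "F' \<subseteq> Pow X" "\<forall>A\<in>F'. c \<le> Suc (card A)"
      "card F1 \<le> card F'" "(\<Sum>A\<in>F1. wt c (card A)) \<le> (\<Sum>A\<in>F'. wt c (card A))"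
      by (elim exE conjE)
    with c1 w1 show ?thesis by (intro exI[of _ F']) auto
  qed
qed

section \<open>Exchanging large sets for sets of size \<open>c\<close>\<close>

text \<open>The two inequalities below account for replacing \<open>f\<close> sets by the \<open>s\<close> (resp. \<open>g\<close>) sets of their
  shadow one level down: the loss in count against the gain in weight. The unit subtracted in the
  first one absorbs the rounding in the final ceiling.\<close>

lemma push_down_gain_base:
  fixes y q s :: real
  assumes c: "c \<ge> 2" and y: "2 * real c + 1 < y" and q: "y \<le> q" and s: "y gchoose c \<le> s"
    and f: "y gchoose Suc c \<le> f"  and fs: "f * (real c + 1) \<le> (y - real c) * s"
  shows "real c * (f - s) \<le> (q - 2 * real c + 1) * (f * (real c / (real c + 2)) - 1)"
proof -
  define z m where "z = y - real c" and "m = y - 2 * real c - 1"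
  have m: "m > 0" and zm: "z = real c + 1 + m" using y by (auto simp: z_def m_def)
  have c2: "real c \<ge> 2" using c by simp
  \<comment> \<open>This leads to \<open>z \<le> f\<close>, the lower bound on \<open>f\<close> that
    absorbs the subtracted unit.\<close>
  have "real c + 1 = real (Suc c) gchoose c"
    using binomial_gbinomial[of "Suc c" c, where 'a = real] by simp
  also have "\<dots> \<le> y gchoose c" using y by (intro gchoose_mono) auto
  finally have "z * (real c + 1) \<le> z * (y gchoose c)" using m zm by (intro mult_left_mono) auto
  also have "\<dots> = (real c + 1) * (y gchoose Suc c)"
    using gchoose_Suc_mult[of c y] by (simp add: z_def add.commute)
  also have "\<dots> \<le> (real c + 1) * f" using f by (intro mult_left_mono) auto
  finally have zf: "z \<le> f" by simp
  have f0: "f > 0" using zf m zm by simp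
  \<comment> \<open>The right-hand side is \<open>z * (m + 2) - (c + 2) * m\<close>, the factor of
    \<open>f * c\<close> left after clearing denominators in the claim.\<close>
  have Q: "2 * (m + 2) \<le> m * m + m + 2 * real c + 2"
  proof -
    have "0 \<le> (m - 1 / 2)\<^sup>2" by simp
    thus ?thesis using c2 by (simp add: power2_eq_square algebra_simps)
  qed
  have "(real c + 2) * z * (m + 2) \<le> (2 * real c) * f * (m + 2)"
    using zf c2 m zm by (intro mult_right_mono mult_mono) auto
  also have "\<dots> = f * real c * (2 * (m + 2))" by simp
  also have "\<dots> \<le> f * real c * (m * m + m + 2 * real c + 2)"
    using Q f0 by (intro mult_left_mono) auto
  finally have key: "(real c + 2) * z * (m + 2) \<le> f * real c * (m * m + m + 2 * real c + 2)" .
  have z0: "z > 0" using m zm by simp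
  have "z * (real c + 2) * (real c * (f - s)) \<le> (real c + 2) * real c * (f * m)"
  proof -
    have "z * (f - s) \<le> f * m" using fs zm by (simp add: z_def algebra_simps)
    hence "((real c + 2) * real c) * (z * (f - s)) \<le> ((real c + 2) * real c) * (f * m)"
      by (intro mult_left_mono) auto
    thus ?thesis by (simp add: mult_ac)
  qed
  also have "\<dots> \<le> z * (m + 2) * (f * real c - (real c + 2))"
    using key by (simp add: zm algebra_simps)
  also have "\<dots> = z * (real c + 2) * ((m + 2) * (f * (real c / (real c + 2)) - 1))"
    by (simp add: field_simps)
  finally have "real c * (f - s) \<le> (m + 2) * (f * (real c / (real c + 2)) - 1)"
    using z0 by (subst (asm) mult_le_cancel_left_pos) auto
  also have "\<dots> \<le> (q - 2 * real c + 1) * (f * (real c / (real c + 2)) - 1)"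
  proof (rule mult_right_mono)
    have "f * (1 / 2) \<le> f * (real c / (real c + 2))"
      using c2 f0 by (intro mult_left_mono) (auto simp: field_simps)
    moreover have "f \<ge> 2" using zf zm m c2 by simp
    ultimately show "0 \<le> f * (real c / (real c + 2)) - 1" by linarith
  qed (use q in \<open>simp add: m_def\<close>)
  finally show ?thesis .
qed

lemma push_down_gain_step:
  fixes y q f g :: real
  assumes ct: "c < t" and c: "c \<ge> 1" and y: "2 * real t + 1 < y" and q: "y \<le> q" and g: "g \<le> f"
    and fg: "f * (real t + 1) \<le> (y - real t) * g"
  shows "real c * (f - g) \<le> (q - 2 * real c + 1) * (g * wt c t - f * wt c (Suc t))"
proof -
  define i m L T where "i = real t - real c" and "m = y - 2 * real t - 1" and "L = f - g"
    and "T = real t + 1"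
  have pos: "i > 0" "m > 0" "L \<ge> 0" "T > 0" and iT: "real c + 1 + i = T"
    using ct y g by (auto simp: i_def m_def L_def T_def)
  define P0 where "P0 = m + 2 + 2 * i"
  have P0: "P0 = y - 2 * real c + 1" "P0 > 0" using pos by (auto simp: P0_def m_def i_def)
  \<comment> \<open>\<open>D\<close> is the drop of \<open>wt c\<close> from \<open>t\<close> to
    \<open>Suc t\<close> and \<open>e\<close> the size of the negative weight at \<open>t\<close>.
    The gain splits into \<open>D\<close> for each of the \<open>f\<close> sets and \<open>e\<close>
    for each of the \<open>L\<close> lost ones.\<close>
  define D e where "D = real c * (real c + 1) / (T * (T + 1))" and "e = - wt c t"
  have e: "e = real c * i / T" by (simp add: e_def wt_def i_def T_def field_simps)
  have e0: "e \<ge> 0" using pos by (simp add: e)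
  have D0: "D \<ge> 0" using pos by (simp add: D_def)
  have De: "- wt c (Suc t) = e + D"
    using pos(4) by (simp add: e_def D_def wt_def T_def divide_simps) (simp add: algebra_simps)
  have E: "g * wt c t - f * wt c (Suc t) = f * D + L * e"
  proof -
    have "g * wt c t - f * wt c (Suc t) = f * (- wt c (Suc t)) - g * (- wt c t)" by simp
    also have "\<dots> = f * (e + D) - g * e" by (simp only: De e_def)
    finally show ?thesis by (simp add: L_def algebra_simps)
  qed
  \<comment> \<open>At most the fraction \<open>m / (T + m)\<close> of the sets is lost; this
    reduces the claim to \<open>key\<close>.\<close>
  have Lf: "L * (T + m) \<le> f * m"
    using fg by (simp add: L_def T_def m_def algebra_simps)
  have f0: "f \<ge> 0"
  proof (rule ccontr)
    assume "\<not> f \<ge> 0"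
    hence "f * m < 0" using pos by (simp add: mult_neg_pos)
    moreover have "L * (T + m) \<ge> 0" using pos by simp
    ultimately show False using Lf by linarith
  qed
  have key: "real c * m \<le> P0 * ((T + m) * D + m * e)"
  proof -
    have "m * (T * (T + 1)) = (real c + 1) * (m * (T + 1)) + m * i * (T + 1)"
      by (simp add: iT[symmetric] algebra_simps)
    also have "\<dots> \<le> (real c + 1) * (P0 * (T + m)) + P0 * (m * i * (T + 1))"
    proof (intro add_mono mult_left_mono)
      have "m * (T + 1) \<le> m * T + 2 * m" using pos by (simp add: algebra_simps)
      also have "\<dots> \<le> m * T + 2 * m + (m * m + 2 * T + 2 * i * T + 2 * i * m)" using pos by simp
      also have "\<dots> = P0 * (T + m)" by (simp add: P0_def algebra_simps)
      finally show "m * (T + 1) \<le> P0 * (T + m)" .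
      have "1 \<le> P0" using pos by (simp add: P0_def)
      hence "1 * (m * i * (T + 1)) \<le> P0 * (m * i * (T + 1))"
        using pos by (intro mult_right_mono) auto
      thus "m * i * (T + 1) \<le> P0 * (m * i * (T + 1))" by simp
    qed auto
    finally have "real c * (m * (T * (T + 1))) \<le>
        real c * ((real c + 1) * (P0 * (T + m)) + P0 * (m * i * (T + 1)))"
      by (intro mult_left_mono) auto
    also have "\<dots> = P0 * ((T + m) * D + m * e) * (T * (T + 1))"
    proof -
      have "D * (T * (T + 1)) = real c * (real c + 1)" "e * T = real c * i"
        using pos(4) by (simp_all add: D_def e)
      thus ?thesis by algebra
    qed
    finally have "real c * m * (T * (T + 1)) \<le> P0 * ((T + m) * D + m * e) * (T * (T + 1))"
      by (simp add: mult_ac)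
    moreover have "T * (T + 1) > 0" using pos by simp
    ultimately show ?thesis by (subst (asm) mult_le_cancel_right_pos)
  qed
  have "m * (real c * L) = L * (real c * m)" by simp
  also have "\<dots> \<le> L * (P0 * ((T + m) * D + m * e))"
    using key pos by (intro mult_left_mono) auto
  also have "\<dots> = P0 * ((L * (T + m)) * D + m * (L * e))" by (simp add: algebra_simps)
  also have "\<dots> \<le> P0 * ((f * m) * D + m * (L * e))"
    using Lf P0 D0 by (intro mult_left_mono add_right_mono mult_right_mono) auto
  also have "\<dots> = m * (P0 * (f * D + L * e))" by (simp add: algebra_simps)
  finally have "real c * L \<le> P0 * (f * D + L * e)" using pos by simp
  also have "\<dots> \<le> (q - 2 * real c + 1) * (f * D + L * e)"
    using q P0 f0 D0 e0 pos by (intro mult_right_mono) auto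
  finally show ?thesis by (simp add: E L_def)
qed

lemma gchoose_root:
  assumes "1 \<le> k" "1 \<le> m"
  obtains y :: real where "real k \<le> y" "y gchoose k = real m"
  using LL_root_ex1[OF assms(1), of "real m"] assms(2) by auto

text \<open>Induction on \<open>d\<close>: the largest sets are exchanged for sets of their shadow
  one level down, while \<open>S\<close> stays fixed, and the gains telescope. Where a level loses
  count, its \<open>c\<close>-shadow lies in \<open>S\<close>, so its root satisfies
  \<open>y \<le> q\<close> and one factor \<open>q - 2 * c + 1\<close> serves throughout.\<close>

lemma large_sets_exchange:
  fixes q :: real
  assumes "c \<ge> 2" "finite B" "antichain B" "\<And>A. A \<in> B \<Longrightarrow> finite A \<and> c < card A \<and> card A \<le> c + 1 + d"
    and "finite S" "lower_shadow c B \<subseteq> S" "real c \<le> q" "q gchoose c = real (card S)" "card S < card B"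
  shows "2 * real c - 1 \<le> q \<and>
     real c * (real (card B) - real (card S)) \<le>
       (q - 2 * real c + 1) * ((\<Sum>A\<in>B. - wt c (card A)) - 1)"
  using assms
proof (induction d arbitrary: B)
  case 0
  note c = 0(1) and finB = 0(2) and S = 0(5,6) and q = 0(7,8) and less = 0(9)
  have B: "finite A \<and> card A = Suc c" if "A \<in> B" for A using 0(4)[OF that] by auto
  have B1: "1 \<le> card B" using less by simp
  obtain y where y: "real (Suc c) \<le> y" "y gchoose Suc c = real (card B)"
    using gchoose_root[OF _ B1, of "Suc c"] by auto
  have "y gchoose c \<le> real (card (lower_shadow c B))"
    using lovasz_shadow[of B "Suc c" y c] B finB y by auto
  also have "\<dots> \<le> card S" using card_mono[OF S] by simp
  finally have Sy: "y gchoose c \<le> real (card S)" .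
  hence yq: "y \<le> q" using gchoose_le_cancel[of c q y] c q by auto
  have rec: "real (card B) * (real c + 1) = (y - real c) * (y gchoose c)"
    using gchoose_Suc_mult[of c y] y by (simp add: mult.commute add.commute)
  have "y > 2 * real c + 1"
  proof (rule ccontr)
    assume "\<not> ?thesis"
    hence "(y - real c) * (y gchoose c) \<le> (real c + 1) * (y gchoose c)"
      using gchoose_ge_1[of c y] y by (intro mult_right_mono) auto
    also have "\<dots> \<le> (real c + 1) * card S" using Sy by (intro mult_left_mono) auto
    finally have "(real c + 1) * card B \<le> (real c + 1) * card S"
      using rec by (simp add: mult.commute)
    thus False using less by (subst (asm) mult_le_cancel_left_pos) auto
  qed
  moreover have "real (card B) * (real c + 1) \<le> (y - real c) * card S"
    unfolding rec using Sy y by (intro mult_left_mono) auto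
  ultimately have "real c * (real (card B) - real (card S)) \<le>
    (q - 2 * real c + 1) * (real (card B) * (real c / (real c + 2)) - 1)"
    using push_down_gain_base[OF c _ yq Sy] y by auto
  moreover have "(\<Sum>A\<in>B. - wt c (card A)) = real (card B) * (real c / (real c + 2))"
  proof -
    have "- wt c (Suc c) = real c / (real c + 2)" by (simp add: wt_def field_simps)
    thus ?thesis using B by simp
  qed
  ultimately show ?case using \<open>y > 2 * real c + 1\<close> yq by auto
next
  case (Suc d)
  note c = Suc.prems(1) and finB = Suc.prems(2) and anti = Suc.prems(3) and B = Suc.prems(4)
    and S = Suc.prems(5,6) and q = Suc.prems(7,8) and less = Suc.prems(9)
  define t where "t = c + 1 + d"
  define T where "T = {A\<in>B. card A = Suc t}"
  define D where "D = lower_shadow t T"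
  have finT: "finite T" using finB by (simp add: T_def)
  have TB: "T \<subseteq> B" by (auto simp: T_def)
  have finD: "finite D"
    unfolding D_def using finT TB B by (intro finite_lower_shadow) auto
  have cD: "card A = t" "finite A" if "A \<in> D" for A
    using that by (auto simp: D_def lower_shadow_def)
  have cB: "card A \<le> t" if "A \<in> B - T" for A
    using B[of A] that by (auto simp: T_def t_def)
  have ct: "c < t" by (simp add: t_def)
  have disj: "(B - T) \<inter> D = {}"
  proof (rule ccontr)
    assume "\<not> ?thesis"
    then obtain A A0 where A: "A \<in> B - T" "A \<in> D" "A0 \<in> T" "A \<subseteq> A0"
      by (auto simp: D_def lower_shadow_def)
    hence "A = A0" using antichainD[OF anti, of A A0] TB by auto
    thus False using A by auto
  qed
  have wtpos: "- wt c i \<ge> 1 / 2" if "c < i" for i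
  proof -
    have "real c * (real c + 1) / (real i + 1) \<le> real c * (real c + 1) / (real c + 2)"
      using that by (intro divide_left_mono) auto
    also have "\<dots> \<le> real c - 1 / 2" using c by (simp add: field_simps)
    finally show ?thesis by (simp add: wt_def)
  qed
  \<comment> \<open>If the shadow is no smaller than \<open>T\<close>, only \<open>card T\<close> of
    its sets are taken, so the count is unchanged and the weight does not decrease. Otherwise all of
    it is taken and the loss is paid for by \<open>gain\<close>.\<close>
  define D' where "D' = (if card T \<le> card D then SOME E. E \<subseteq> D \<and> card E = card T else D)"
  have "\<exists>E. E \<subseteq> D \<and> card E = card T" if "card T \<le> card D"
    using obtain_subset_with_card_n[OF that] by metis
  hence D': "D' \<subseteq> D" "card D' = min (card T) (card D)"
    using someI_ex[of "\<lambda>E. E \<subseteq> D \<and> card E = card T"] by (auto simp: D'_def)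
  have finD': "finite D'" using D'(1) finD finite_subset by blast
  define B1 where "B1 = (B - T) \<union> D'"
  have fin1: "finite B1" using finB finD' by (simp add: B1_def)
  have B1: "finite A \<and> c < card A \<and> card A \<le> c + 1 + d" if "A \<in> B1" for A
    using that B[of A] cB[of A] cD[of A] D'(1) ct by (auto simp: B1_def t_def)
  have anti1: "antichain B1"
    unfolding antichain_def
  proof (intro ballI impI)
    fix A A' assume AA: "A \<in> B1" "A' \<in> B1" "A \<subseteq> A'"
    show "A = A'"
    proof (cases "A \<in> D'")
      case True
      hence "card A = t" using cD(1) D'(1) by auto
      moreover have "card A' \<le> t" using AA(2) cB[of A'] cD(1)[of A'] D'(1) by (auto simp: B1_def)
      ultimately have "card A' \<le> card A" by simp
      thus ?thesis using card_seteq[of A' A] AA B1 by auto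
    next
      case False
      hence A: "A \<in> B - T" using AA by (auto simp: B1_def)
      have "A' \<notin> D'"
      proof
        assume "A' \<in> D'"
        then obtain A0 where A0: "A0 \<in> T" "A' \<subseteq> A0"
          using D'(1) by (auto simp: D_def lower_shadow_def)
        have "A = A0" using antichainD[OF anti, of A A0] A A0 TB AA by auto
        thus False using A A0 by auto
      qed
      hence "A' \<in> B - T" using AA by (auto simp: B1_def)
      thus ?thesis using antichainD[OF anti, of A A'] A AA by auto
    qed
  qed
  have S1: "lower_shadow c B1 \<subseteq> S"
  proof -
    have "lower_shadow c D' \<subseteq> lower_shadow c T"
      using lower_shadow_mono[OF D'(1)] lower_shadow_lower_shadow_subset unfolding D_def by blast
    hence "lower_shadow c B1 \<subseteq> lower_shadow c B"
      using TB unfolding B1_def lower_shadow_def by blast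
    thus ?thesis using S by blast
  qed
  have disj': "(B - T) \<inter> D' = {}" using disj D'(1) by blast
  have cBT: "card B = card (B - T) + card T"
    using card_Diff_subset[OF finT TB] card_mono[OF finB TB] by simp
  have cB1: "card B1 = card (B - T) + card D'"
    unfolding B1_def using finB finD' disj' by (intro card_Un_disjoint) auto
  define E E1 where "E = (\<Sum>A\<in>B. - wt c (card A))" and "E1 = (\<Sum>A\<in>B1. - wt c (card A))"
  have "E = (\<Sum>A\<in>B - T. - wt c (card A)) + (\<Sum>A\<in>T. - wt c (card A))"
    unfolding E_def using TB finB by (rule sum.subset_diff)
  moreover have "(\<Sum>A\<in>T. - wt c (card A)) = - card T * wt c (Suc t)" by (simp add: T_def)
  moreover have "E1 = (\<Sum>A\<in>B - T. - wt c (card A)) + (\<Sum>A\<in>D'. - wt c (card A))"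
    unfolding E1_def B1_def using finB finD' disj' by (intro sum.union_disjoint) auto
  moreover have "(\<Sum>A\<in>D'. - wt c (card A)) = - card D' * wt c t"
    using cD D'(1) by (simp add: subset_iff)
  ultimately have EE: "E = E1 + (card D' * wt c t - card T * wt c (Suc t))" by simp
  note IH = Suc.IH[OF c fin1 anti1 B1 S(1) S1 q, folded E1_def]
  show ?case
  proof (cases "card T \<le> card D")
    case True
    hence eq: "card D' = card T" "card B1 = card B" using D' cBT cB1 by auto
    have "wt c (Suc t) \<le> wt c t"
      unfolding wt_def by (intro diff_right_mono divide_left_mono) auto
    hence "E1 \<le> E" unfolding EE eq by (simp add: mult_left_mono)
    moreover have I: "2 * real c - 1 \<le> q" "real c * (real (card B) - real (card S)) \<le>
       (q - 2 * real c + 1) * (E1 - 1)" using IH eq less by auto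
    ultimately have "(q - 2 * real c + 1) * (E1 - 1) \<le> (q - 2 * real c + 1) * (E - 1)"
      by (intro mult_left_mono) auto
    thus ?thesis using I unfolding E_def by auto
  next
    case False
    hence D'D: "D' = D" and gl: "card D < card T" by (auto simp: D'_def)
    have T1: "1 \<le> card T" using gl by simp
    obtain y where y: "real (Suc t) \<le> y" "y gchoose Suc t = real (card T)"
      using gchoose_root[OF _ T1, of "Suc t"] by auto
    have Tt: "finite A \<and> card A = Suc t" if "A \<in> T" for A using that B by (auto simp: T_def)
    have Dy: "y gchoose t \<le> real (card D)"
      unfolding D_def using lovasz_shadow[of T "Suc t" y t] Tt finT y by auto
    have "y gchoose c \<le> real (card (lower_shadow c T))"
      using lovasz_shadow[of T "Suc t" y c] Tt finT y ct by auto
    also have "\<dots> \<le> card S"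
      using card_mono[OF S(1), of "lower_shadow c T"] lower_shadow_mono[OF TB, of c] S(2) by auto
    finally have yq: "y \<le> q" using gchoose_le_cancel[of c q y] c q by auto
    have rec: "real (card T) * (real t + 1) = (y - real t) * (y gchoose t)"
      using gchoose_Suc_mult[of t y] y by (simp add: mult.commute add.commute)
    have y2: "y > 2 * real t + 1"
    proof (rule ccontr)
      assume "\<not> ?thesis"
      hence "(y - real t) * (y gchoose t) \<le> (real t + 1) * (y gchoose t)"
        using gchoose_ge_1[of t y] y by (intro mult_right_mono) auto
      also have "\<dots> \<le> (real t + 1) * card D" using Dy by (intro mult_left_mono) auto
      finally have "(real t + 1) * card T \<le> (real t + 1) * card D"
        using rec by (simp add: mult.commute)
      thus False using gl by (subst (asm) mult_le_cancel_left_pos) auto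
    qed
    have gain: "real c * (real (card T) - real (card D)) \<le> (q - 2 * real c + 1) * (E - E1)"
    proof -
      have "real (card T) * (real t + 1) \<le> (y - real t) * card D"
        unfolding rec using Dy y by (intro mult_left_mono) auto
      thus ?thesis
        using push_down_gain_step[OF ct _ y2 yq] gl c EE D'D by auto
    qed
    have q2: "2 * real c - 1 \<le> q" using y2 yq ct by simp
    have I: "real c * (real (card B1) - real (card S)) \<le> (q - 2 * real c + 1) * (E1 - 1)"
    proof (cases "card S < card B1")
      case True
      thus ?thesis using IH by auto
    next
      case False
      have "real (Suc t) = real (Suc t) gchoose t"
        using binomial_gbinomial[of "Suc t" t, where 'a = real] by simp
      also have "\<dots> \<le> y gchoose t" using y by (intro gchoose_mono) auto
      also note Dy
      also have "real (card D) \<le> real (card B1)" using cB1 D'D by simp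
      finally have "2 \<le> real (card B1)" using ct by simp
      also have "card B1 * (1 / 2) \<le> E1"
        unfolding E1_def by (rule sum_bounded_below) (use wtpos B1 in auto)
      ultimately have "E1 \<ge> 1" by linarith
      hence "0 \<le> (q - 2 * real c + 1) * (E1 - 1)" using q2 by simp
      moreover have "real c * (real (card B1) - real (card S)) \<le> 0"
        using False by (simp add: mult_nonneg_nonpos)
      ultimately show ?thesis by linarith
    qed
    have "real c * (real (card B) - real (card S)) =
        real c * (real (card B1) - real (card S)) + real c * (real (card T) - real (card D))"
      using cBT cB1 D'D by (simp add: algebra_simps)
    also have "\<dots> \<le> (q - 2 * real c + 1) * (E1 - 1) + (q - 2 * real c + 1) * (E - E1)"
      by (intro add_mono I gain)
    also have "\<dots> = (q - 2 * real c + 1) * (E - 1)" by (simp add: algebra_simps)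
    finally show ?thesis using q2 unfolding E_def by simp
  qed
qed

section \<open>Growth of the function \<open>LL c\<close>\<close>

lemma LL_gchoose:
  assumes "c \<ge> 1" "real c \<le> q"
  shows "LL c (q gchoose c) = q gchoose (c - 1)"
proof -
  have g: "1 \<le> q gchoose c" using gchoose_ge_1[OF assms(2)] .
  have "(THE q'::real. real c \<le> q' \<and> q' gchoose c = q gchoose c) = q"
    by (rule the1_equality[OF LL_root_ex1[OF assms(1) g]]) (use assms in simp)
  thus ?thesis using g by (simp add: LL_def)
qed

lemma LL_0 [simp]: "LL c 0 = 0"
  by (simp add: LL_def)

text \<open>This gives \<open>LL c x = c * x / (q - c + 1)\<close>, from which the slope estimates
  follow without derivatives.\<close>

lemma LL_mult_root:
  assumes "c \<ge> 1" "real c \<le> q"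
  shows "(q - real c + 1) * LL c (q gchoose c) = real c * (q gchoose c)"
  using gchoose_Suc_mult[of "c - 1" q] assms by (simp add: LL_gchoose of_nat_diff algebra_simps)

lemma LL_nonneg:
  assumes "c \<ge> 1"
  shows "0 \<le> LL c (real m)"
proof (cases "m = 0")
  case False
  then obtain q where q: "real c \<le> q" "q gchoose c = real m"
    using gchoose_root[OF assms, of m] by auto
  have "1 \<le> q gchoose (c - 1)" using q by (intro gchoose_ge_1) auto
  thus ?thesis using LL_gchoose[OF assms q(1)] q by simp
qed simp

lemma LL_mono:
  assumes "c \<ge> 1" "m \<le> m'"
  shows "LL c (real m) \<le> LL c (real m')"
proof (cases "m = 0")
  case True
  thus ?thesis using LL_nonneg[OF assms(1)] by simp
next
  case False
  obtain q where q: "real c \<le> q" "q gchoose c = real m"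
    using gchoose_root[OF assms(1), of m] False by auto
  obtain q' where q': "real c \<le> q'" "q' gchoose c = real m'"
    using gchoose_root[OF assms(1), of m'] False assms(2) by auto
  have "q \<le> q'" by (rule gchoose_le_cancel[OF assms(1)]) (use q q' assms in auto)
  hence "q gchoose (c - 1) \<le> q' gchoose (c - 1)"
    using q by (intro gchoose_mono) auto
  thus ?thesis using LL_gchoose[OF assms(1) q(1)] LL_gchoose[OF assms(1) q'(1)] q q' by simp
qed

text \<open>A slope bound \<open>c / (q - c + 1)\<close> to the right of \<open>q gchoose c\<close>:
  by \<open>LL_mult_root\<close> the right-hand side is a difference of products whose factors
  \<open>q1 - c + 1\<close> and \<open>q2 - c + 1\<close> are at least \<open>q - c + 1\<close> and
  increase.\<close>

lemma LL_diff_le: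
  assumes c: "c \<ge> 1" and q: "real c \<le> q" "q gchoose c \<le> real v" and va: "v \<le> a"
  shows "(q - real c + 1) * (LL c (real a) - LL c (real v)) \<le> real c * (real a - real v)"
proof -
  have v1: "1 \<le> v" using gchoose_ge_1[OF q(1)] q(2) by simp
  obtain q1 where q1: "real c \<le> q1" "q1 gchoose c = real v"
    using gchoose_root[OF c v1] by auto
  obtain q2 where q2: "real c \<le> q2" "q2 gchoose c = real a"
    using gchoose_root[OF c, of a] v1 va by auto
  have qq: "q \<le> q1" "q1 \<le> q2"
    by (rule gchoose_le_cancel[OF c]; use q q1 q2 va in simp)+
  note mono = LL_mono[OF c va]
  have "(q - real c + 1) * (LL c a - LL c v) \<le> (q1 - real c + 1) * (LL c a - LL c v)"
    using qq mono by (intro mult_right_mono) auto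
  also have "\<dots> \<le> (q2 - real c + 1) * LL c a - (q1 - real c + 1) * LL c v"
    using mult_right_mono[OF qq(2) LL_nonneg[OF c, of a]] by (simp add: algebra_simps)
  also have "\<dots> = real c * (real a - real v)"
    using LL_mult_root[OF c q1(1)] LL_mult_root[OF c q2(1)] q1 q2 by (simp add: algebra_simps)
  finally show ?thesis .
qed

lemma gchoose_central: "c \<ge> 1 \<Longrightarrow> (2 * real c - 1) gchoose c = real (2 * c - 1 choose c)"
  by (simp add: binomial_gbinomial of_nat_diff)

text \<open>At \<open>q = 2 * c - 1\<close> the factor \<open>q - c + 1\<close> equals
  \<open>c\<close>, which makes this value a fixed point.\<close>

lemma LL_central:
  assumes "c \<ge> 1"
  shows "LL c (real (2 * c - 1 choose c)) = real (2 * c - 1 choose c)"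
  using LL_mult_root[of c "2 * real c - 1"] assms by (simp add: gchoose_central)

text \<open>Beyond the fixed point the slope is at most 1; below it \<open>LL c\<close> lies on or
  above the diagonal, so \<open>v\<close> may be small.\<close>

lemma LL_diff_le_diff:
  assumes c: "c \<ge> 1" and va: "v \<le> a" and M: "2 * c - 1 choose c \<le> a"
  shows "LL c (real a) - LL c (real v) \<le> real a - real v"
proof -
  let ?M = "2 * c - 1 choose c"
  have lip: "LL c (real a) - LL c (real w) \<le> real a - real w" if "?M \<le> w" "w \<le> a" for w
    using LL_diff_le[OF c, of "2 * real c - 1" w a] that c by (simp add: gchoose_central)
  show ?thesis
  proof (cases "?M \<le> v")
    case True
    thus ?thesis using lip va by blast
  next
    case False
    have "real v \<le> LL c (real v)"
    proof (cases "v = 0")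
      case v: False
      then obtain q where q: "real c \<le> q" "q gchoose c = real v"
        using gchoose_root[OF c, of v] by auto
      have "q \<le> 2 * real c - 1"
        by (rule gchoose_le_cancel[OF c]) (use q False c in \<open>auto simp: gchoose_central\<close>)
      hence "(q - real c + 1) * LL c v \<le> real c * LL c v"
        using LL_nonneg[OF c] by (intro mult_right_mono) auto
      hence "real c * real v \<le> real c * LL c v"
        using LL_mult_root[OF c q(1)] q by simp
      thus ?thesis using c by simp
    qed simp
    thus ?thesis using lip[OF order_refl M] LL_central[OF c] by simp
  qed
qed

lemma LL_le_card_lower_shadow:
  assumes "c \<ge> 1" "finite F" "\<And>A. A \<in> F \<Longrightarrow> finite A \<and> card A = c"
  shows "LL c (real (card F)) \<le> real (card (lower_shadow (c - 1) F))"
proof (cases "card F = 0")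
  case False
  then obtain q where q: "real c \<le> q" "q gchoose c = real (card F)"
    using gchoose_root[OF assms(1), of "card F"] by auto
  have "q gchoose (c - 1) \<le> real (card (lower_shadow (c - 1) F))"
    using lovasz_shadow[OF assms(2,3) q(1)] q(2) by auto
  thus ?thesis using LL_gchoose[OF assms(1) q(1)] q by simp
qed simp

section \<open>The inequality for antichains\<close>

text \<open>The bound \<open>UL\<close> for sizes \<open>c - 1\<close> and \<open>c\<close> is
  compared with the claim. If replacing \<open>B\<close> by \<open>S\<close> loses no sets, slope at
  most 1 is enough; otherwise the exchange inequality pays. The strict bound with \<open>+ 1\<close>
  on \<open>b\<close> fits a ceiling.\<close>

lemma antichain_LL_bound:
  assumes c: "c \<ge> 2" and X: "finite X" "3 * c \<le> card X" and F: "antichain F" "F \<subseteq> Pow X"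
    and ab: "a + b \<le> card F" and b: "real b < (\<Sum>A\<in>F. wt c (card A)) + 1"
    and a: "a = 0 \<or> 2 * c - 1 choose c \<le> a"
  shows "real b + LL c (real a) \<le> real (card X choose (c - 1))"
proof -
  have c1: "c \<ge> 1" using c by simp
  obtain G where G: "antichain G" "G \<subseteq> Pow X" "\<And>A. A \<in> G \<Longrightarrow> c \<le> Suc (card A)"
    "card F \<le> card G" "(\<Sum>A\<in>F. wt c (card A)) \<le> (\<Sum>A\<in>G. wt c (card A))"
    using antichain_lift[OF X F, of 0] by auto
  have finG: "finite G" using finite_subset[OF G(2)] X(1) by simp
  have finA: "finite A" if "A \<in> G" for A using that G(2) finite_subset[OF _ X(1)] by blast
  define U V B S where "U = {A\<in>G. card A = c - 1}" and "V = {A\<in>G. card A = c}"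
    and "B = {A\<in>G. c < card A}" and "S = lower_shadow c B"
  have fin: "finite U" "finite V" "finite B" using finG by (auto simp: U_def V_def B_def)
  have finS: "finite S" unfolding S_def using fin finA by (intro finite_lower_shadow) (auto simp: B_def)
  have split: "G = U \<union> (V \<union> B)"
  proof
    show "G \<subseteq> U \<union> (V \<union> B)"
    proof
      fix A assume "A \<in> G"
      thus "A \<in> U \<union> (V \<union> B)" using G(3)[of A] by (auto simp: U_def V_def B_def)
    qed
  qed (auto simp: U_def V_def B_def)
  have disj: "U \<inter> (V \<union> B) = {}" "V \<inter> B = {}" using c by (auto simp: U_def V_def B_def)
  have cardG: "card G = card U + (card V + card B)"
    unfolding split using fin disj by (subst card_Un_disjoint; simp add: card_Un_disjoint)
  define E where "E = (\<Sum>A\<in>B. - wt c (card A))"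
  have "(\<Sum>A\<in>G. wt c (card A)) =
      (\<Sum>A\<in>U. wt c (card A)) + ((\<Sum>A\<in>V. wt c (card A)) + (\<Sum>A\<in>B. wt c (card A)))"
    unfolding split using fin disj by (subst sum.union_disjoint; simp add: sum.union_disjoint)
  moreover have "(\<Sum>A\<in>U. wt c (card A)) = real (card U)"
    using c by (simp add: U_def wt_def of_nat_diff)
  moreover have "(\<Sum>A\<in>V. wt c (card A)) = 0"
    by (simp add: V_def wt_def)
  moreover have "(\<Sum>A\<in>B. wt c (card A)) = - E" by (simp add: E_def sum_negf)
  ultimately have WU: "(\<Sum>A\<in>G. wt c (card A)) = real (card U) - E" by simp
  have E0: "E \<ge> 0"
    unfolding E_def
  proof (rule sum_nonneg)
    fix A assume "A \<in> B"
    hence "real c * (real c + 1) / (real (card A) + 1) \<le> real c * (real c + 1) / (real c + 1)"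
      by (intro divide_left_mono) (auto simp: B_def)
    thus "0 \<le> - wt c (card A)" by (simp add: wt_def)
  qed
  have bU: "real b + E < real (card U) + 1" using b G(5) WU by simp
  hence bU': "b \<le> card U" using E0 by simp
  define v where "v = card V + card S"
  have VS: "V \<inter> S = {}"
  proof (rule ccontr)
    assume "\<not> ?thesis"
    then obtain A B0 where A: "A \<in> V" "B0 \<in> B" "A \<subseteq> B0" by (auto simp: S_def lower_shadow_def)
    hence "A = B0" using antichainD[OF G(1), of A B0] by (auto simp: V_def B_def)
    thus False using A by (auto simp: V_def B_def)
  qed
  have v: "v = card (V \<union> S)" using fin finS VS by (simp add: v_def card_Un_disjoint)
  \<comment> \<open>Every set in the shadow of \<open>V \<union> S\<close> lies inside a set of
    \<open>V \<union> B\<close>, so a member shared with \<open>U\<close> would violate the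
    antichain property.\<close>
  have UL: "real (card U) + LL c (real v) \<le> real (card X choose (c - 1))"
  proof -
    let ?L = "lower_shadow (c - 1) (V \<union> S)"
    have VSc: "finite A \<and> card A = c" if "A \<in> V \<union> S" for A
      using that finA by (auto simp: V_def S_def lower_shadow_def)
    have "LL c (real v) \<le> real (card ?L)"
      unfolding v using fin finS VSc by (intro LL_le_card_lower_shadow[OF c1]) auto
    moreover have "card U + card ?L \<le> card X choose (c - 1)"
    proof -
      have LG: "\<exists>B0\<in>V \<union> B. A \<subseteq> B0" if "A \<in> ?L" for A
        using that unfolding S_def lower_shadow_def by blast
      have "U \<inter> ?L = {}"
      proof (rule ccontr)
        assume "\<not> ?thesis"
        then obtain A B0 where A: "A \<in> U" "B0 \<in> V \<union> B" "A \<subseteq> B0" using LG by blast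
        hence "A = B0" using antichainD[OF G(1), of A B0] by (auto simp: U_def V_def B_def)
        thus False using A disj by auto
      qed
      moreover have finL: "finite ?L"
        using fin finS VSc by (intro finite_lower_shadow) auto
      ultimately have "card U + card ?L = card (U \<union> ?L)"
        using fin by (simp add: card_Un_disjoint)
      also have "\<dots> \<le> card {A. A \<subseteq> X \<and> card A = c - 1}"
      proof (rule card_mono)
        show "U \<union> ?L \<subseteq> {A. A \<subseteq> X \<and> card A = c - 1}"
        proof
          fix A assume A: "A \<in> U \<union> ?L"
          hence "card A = c - 1" by (auto simp: U_def lower_shadow_def)
          moreover have "\<exists>B0\<in>G. A \<subseteq> B0" using A LG[of A] split by blast
          hence "A \<subseteq> X" using G(2) by blast
          ultimately show "A \<in> {A. A \<subseteq> X \<and> card A = c - 1}" by simp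
        qed
      qed (use X(1) in simp)
      also have "\<dots> = card X choose (c - 1)" by (rule n_subsets[OF X(1)])
      finally show ?thesis .
    qed
    ultimately show ?thesis by linarith
  qed
  have "real b + LL c (real a) \<le> real (card U) + LL c (real v)"
  proof (cases "a \<le> v")
    case True
    thus ?thesis using LL_mono[OF c1 True] bU' by simp
  next
    case False
    hence va: "v \<le> a" and a': "2 * c - 1 choose c \<le> a" using a by auto
    have tot: "real a + real b \<le> real (card U) + (real v - real (card S) + real (card B))"
      using ab G(4) cardG by (simp add: v_def)
    show ?thesis
    proof (cases "card S < card B")
      case False
      hence "real a - real v \<le> real (card U) - real b" using tot by simp
      thus ?thesis using LL_diff_le_diff[OF c1 va a'] by linarith
    next
      case True
      have antiB: "antichain B" using G(1) by (auto simp: antichain_def B_def)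
      obtain B0 where B0: "B0 \<in> B" using True by fastforce
      obtain A0 where "A0 \<subseteq> B0" "card A0 = c" "finite A0"
        using obtain_subset_with_card_n[of c B0] B0 by (auto simp: B_def)
      hence "A0 \<in> S" using B0 by (auto simp: S_def lower_shadow_def)
      hence "1 \<le> card S" using finS by (cases "card S") auto
      then obtain q where q: "real c \<le> q" "q gchoose c = real (card S)"
        using gchoose_root[OF c1] by blast
      \<comment> \<open>A crude size bound, giving the value \<open>card X\<close> for the induction
        parameter \<open>d\<close> of the exchange.\<close>
      have Bd: "finite A \<and> c < card A \<and> card A \<le> c + 1 + card X" if "A \<in> B" for A
        using that finA G(2) card_mono[OF X(1), of A] by (auto simp: B_def)
      have q2: "2 * real c - 1 \<le> q" and ex: "real c * (real (card B) - real (card S)) \<le>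
          (q - 2 * real c + 1) * (E - 1)"
        using large_sets_exchange[OF c fin(3) antiB Bd finS _ q True] by (auto simp: S_def E_def)
      \<comment> \<open>In terms of the surplus \<open>e\<close>, \<open>bU\<close> reads
        \<open>E - 1 < e\<close>: this is why the exchange subtracts a unit.\<close>
      define e where "e = real (card U) - real b"
      have "(q - 2 * real c + 1) * (E - 1) \<le> (q - 2 * real c + 1) * e"
        using q2 bU by (intro mult_left_mono) (auto simp: e_def)
      hence ex': "real c * (real (card B) - real (card S)) \<le> (q - 2 * real c + 1) * e"
        using ex by linarith
      have "(q - real c + 1) * (LL c (real a) - LL c (real v)) \<le> real c * (real a - real v)"
        using q va by (intro LL_diff_le[OF c1]) (auto simp: v_def)
      also have "\<dots> \<le> real c * (e + (real (card B) - real (card S)))"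
        using tot by (intro mult_left_mono) (auto simp: e_def)
      \<comment> \<open>The terms \<open>c * e\<close> and \<open>(q - 2 * c + 1) * e\<close> add up
        to \<open>(q - c + 1) * e\<close>, which explains the factor in the exchange
        inequality.\<close>
      also have "\<dots> \<le> (q - real c + 1) * e"
        using ex' by (simp add: algebra_simps)
      finally have "LL c (real a) - LL c (real v) \<le> e"
        using q by (subst (asm) mult_le_cancel_left_pos) auto
      thus ?thesis by (simp add: e_def)
    qed
  qed
  thus ?thesis using UL by linarith
qed

section \<open>From partition systems to antichains\<close>

text \<open>Every class spreads total weight 1 evenly over its points, so the point weights sum to
  \<open>k * card P\<close> and some \<open>x\<close> reaches the average.\<close>

lemma sperner_partition_system_link:
  assumes P: "sperner_partition_system X k P" and X: "finite X" "X \<noteq> {}"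
  obtains x F where "x \<in> X" "antichain F" "F \<subseteq> Pow (X - {x})" "card F = card P"
    "real (k * card P) / real (card X) \<le> (\<Sum>A\<in>F. 1 / (real (card A) + 1))"
proof -
  define C where "C = \<Union>P"
  have part: "partition_on X p" "card p = k" if "p \<in> P" for p
    using P that by (auto simp: sperner_partition_system_def)
  have sp: "\<not> A \<subseteq> B" if "p \<in> P" "q \<in> P" "p \<noteq> q" "A \<in> p" "B \<in> q" for p q A B
    using P that unfolding sperner_partition_system_def by blast
  have CX: "A \<subseteq> X" "A \<noteq> {}" if "A \<in> C" for A
    using that part by (auto simp: C_def partition_on_def)
  have finC: "finite C" by (rule finite_subset[of _ "Pow X"]) (use CX X in auto)
  have finP: "finite P"
    by (rule finite_subset[of _ "Pow C"]) (use finC in \<open>auto simp: C_def\<close>)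
  have finA: "finite A" if "A \<in> C" for A using CX(1)[OF that] X(1) finite_subset by blast
  have finp: "finite p" if "p \<in> P" for p
    by (rule finite_subset[OF _ finC]) (use that in \<open>auto simp: C_def\<close>)
  have antiC: "A = B" if AB: "A \<in> C" "B \<in> C" "A \<subseteq> B" for A B
  proof -
    obtain p q where pq: "p \<in> P" "q \<in> P" "A \<in> p" "B \<in> q" using AB by (auto simp: C_def)
    have "p = q" using sp[OF pq(1,2) _ pq(3,4)] AB(3) by blast
    thus ?thesis using part(1)[OF pq(1)] pq AB(3) CX(2)[OF AB(1)]
      unfolding partition_on_def disjoint_def by blast
  qed
  \<comment> \<open>A common class would be a subset of itself, against the Sperner
    condition.\<close>
  have disj: "p \<inter> q = {}" if "p \<in> P" "q \<in> P" "p \<noteq> q" for p q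
    using sp[OF that] by blast
  have cardC: "card C = k * card P"
  proof -
    have "card C = (\<Sum>p\<in>P. card p)"
      unfolding C_def using disj finp by (intro card_Union_disjoint) (auto simp: pairwise_def disjnt_def)
    also have "\<dots> = k * card P" using part(2) by simp
    finally show ?thesis .
  qed
  have cardx: "card {A\<in>C. x \<in> A} = card P" if x: "x \<in> X" for x
  proof -
    have one: "card {A\<in>p. x \<in> A} = 1" if p: "p \<in> P" for p
    proof -
      obtain A where A: "A \<in> p" "x \<in> A" using part(1)[OF p] x by (auto simp: partition_on_def)
      have "{A\<in>p. x \<in> A} = {A}"
        using A part(1)[OF p] unfolding partition_on_def disjoint_def by blast
      thus ?thesis by simp
    qed
    have "{A\<in>C. x \<in> A} = (\<Union>p\<in>P. {A\<in>p. x \<in> A})" by (auto simp: C_def)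
    also have "card \<dots> = (\<Sum>p\<in>P. card {A\<in>p. x \<in> A})"
    proof (rule card_UN_disjoint[OF finP])
      show "\<forall>p\<in>P. finite {A\<in>p. x \<in> A}" using finp by simp
      show "\<forall>p\<in>P. \<forall>q\<in>P. p \<noteq> q \<longrightarrow> {A\<in>p. x \<in> A} \<inter> {A\<in>q. x \<in> A} = {}"
        using disj by blast
    qed
    finally show ?thesis using one by simp
  qed
  have "(\<Sum>x\<in>X. \<Sum>A\<in>{A\<in>C. x \<in> A}. 1 / real (card A)) = (\<Sum>A\<in>C. \<Sum>x\<in>{x\<in>X. x \<in> A}. 1 / real (card A))"
    by (rule sum.swap_restrict[OF X(1) finC])
  also have "\<dots> = (\<Sum>A\<in>C. 1)"
  proof (rule sum.cong[OF refl])
    fix A assume A: "A \<in> C"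
    have "{x\<in>X. x \<in> A} = A" using CX(1)[OF A] by auto
    thus "(\<Sum>x\<in>{x\<in>X. x \<in> A}. 1 / real (card A)) = 1"
      using CX(2)[OF A] finA[OF A] by simp
  qed
  finally have total: "(\<Sum>x\<in>X. \<Sum>A\<in>{A\<in>C. x \<in> A}. 1 / real (card A)) = real (k * card P)"
    using cardC by simp
  have "\<exists>x\<in>X. real (k * card P) / real (card X) \<le> (\<Sum>A\<in>{A\<in>C. x \<in> A}. 1 / real (card A))"
  proof (rule ccontr)
    assume "\<not> ?thesis"
    hence "(\<Sum>x\<in>X. \<Sum>A\<in>{A\<in>C. x \<in> A}. 1 / real (card A)) <
        (\<Sum>x\<in>X. real (k * card P) / real (card X))"
      using X by (intro sum_strict_mono) auto
    thus False using total X by simp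
  qed
  then obtain x where x: "x \<in> X"
    "real (k * card P) / real (card X) \<le> (\<Sum>A\<in>{A\<in>C. x \<in> A}. 1 / real (card A))" by blast
  define F where "F = (\<lambda>A. A - {x}) ` {A\<in>C. x \<in> A}"
  have inj: "inj_on (\<lambda>A. A - {x}) {A\<in>C. x \<in> A}" by (rule inj_on_remove) simp
  show thesis
  proof
    show "antichain F"
      unfolding antichain_def F_def using antiC by blast
    show "F \<subseteq> Pow (X - {x})" using CX(1) by (auto simp: F_def)
    show "card F = card P" unfolding F_def using card_image[OF inj] cardx[OF x(1)] by simp
    have "(\<Sum>A\<in>F. 1 / (real (card A) + 1)) = (\<Sum>A\<in>{A\<in>C. x \<in> A}. 1 / (real (card (A - {x})) + 1))"
      unfolding F_def using inj by (simp add: sum.reindex)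
    also have "\<dots> = (\<Sum>A\<in>{A\<in>C. x \<in> A}. 1 / real (card A))"
    proof (rule sum.cong[OF refl])
      fix A assume "A \<in> {A\<in>C. x \<in> A}"
      hence "Suc (card (A - {x})) = card A" using finA by (intro card_Suc_Diff1) auto
      thus "1 / (real (card (A - {x})) + 1) = 1 / real (card A)" by (metis of_nat_Suc add.commute)
    qed
    finally show "real (k * card P) / real (card X) \<le> (\<Sum>A\<in>F. 1 / (real (card A) + 1))"
      using x(2) by simp
  qed (rule x(1))
qed

section \<open>Numerical estimates for few partitions\<close>

lemma binomial_absorb3:
  "(d + 1) * (d + 2) * (d + 3) * (N choose (d + 3)) = N * (N - 1) * (N - 2) * (N - 3 choose d)"
proof -
  have "(d + 3) * (N choose (d + 3)) = N * (N - 1 choose (d + 2))"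
    using binomial_absorption[of "d + 2" N] by (simp add: eval_nat_numeral)
  moreover have "(d + 2) * (N - 1 choose (d + 2)) = (N - 1) * (N - 2 choose (d + 1))"
    using binomial_absorption[of "d + 1" "N - 1"] by (simp add: eval_nat_numeral)
  moreover have "(d + 1) * (N - 2 choose (d + 1)) = (N - 2) * (N - 3 choose d)"
    using binomial_absorption[of d "N - 2"] by (simp add: eval_nat_numeral)
  ultimately show ?thesis by algebra
qed

text \<open>Three factors are split off both coefficients, which needs \<open>c \<ge> 4\<close>. The
  constant 4 comes from \<open>N - 1 \<ge> 2 * (2 * c - 2)\<close> and
  \<open>N - 2 \<ge> 2 * (2 * c - 3)\<close>.\<close>

lemma binomial_ratio_bound:
  assumes c: "c \<ge> 4" and N: "4 * c \<le> N"
  shows "4 * N * (2 * c - 1 choose c) \<le> (2 * c - 1) * (N choose (c - 1))"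
proof -
  obtain d where d: "c = d + 4" using c by (metis add.commute le_Suc_ex)
  have c3: "c - 1 = d + 3" using d by simp
  define K H where "K = (d + 1) * (d + 2) * (d + 3)" and "H = (2 * c - 4 choose d)"
  have sym: "(2 * c - 1 choose c) = (2 * c - 1 choose (d + 3))"
    using binomial_symmetric[of c "2 * c - 1"] d by simp
  have diffs: "2 * c - 1 - 1 = 2 * c - 2" "2 * c - 1 - 2 = 2 * c - 3" "2 * c - 1 - 3 = 2 * c - 4"
    by simp_all
  have rearrange: "4 * N * (x * y * z * h) = x * (N * (2 * y) * (2 * z) * h)" for x y z h :: nat
    by simp
  have "K * (4 * N * (2 * c - 1 choose c)) = 4 * N * (K * (2 * c - 1 choose (d + 3)))"
    unfolding sym by simp
  also have "\<dots> = 4 * N * ((2 * c - 1) * (2 * c - 2) * (2 * c - 3) * H)"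
    by (simp only: K_def H_def binomial_absorb3 diffs)
  also have "\<dots> = (2 * c - 1) * (N * (2 * (2 * c - 2)) * (2 * (2 * c - 3)) * H)" by simp
  also have "\<dots> \<le> (2 * c - 1) * (N * (N - 1) * (N - 2) * (N - 3 choose d))"
    unfolding H_def using N c by (intro mult_le_mono binomial_right_mono) auto
  also have "\<dots> = K * ((2 * c - 1) * (N choose (c - 1)))"
    unfolding binomial_absorb3[symmetric] K_def c3 by (simp only: mult_ac)
  finally show ?thesis by (simp add: K_def)
qed

text \<open>Serves the range where \<open>a\<close> is positive but below the fixed point of
  \<open>LL c\<close>: there the two terms are at most \<open>p\<close> and the central
  coefficient.\<close>

lemma few_partitions_bound:
  fixes n k c r p :: nat
  assumes n: "n \<ge> 2 * k + 2" and k: "k \<ge> 4" and nck: "n = c * k + r" and r: "1 \<le> r" and c: "c \<ge> 2"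
    and p: "p * (r * (c + 1)) < (2 * c - 1 choose c) * n"
  shows "p + (2 * c - 1 choose c) \<le> (n - 1) choose (c - 1)"
proof -
  let ?M = "2 * c - 1 choose c"
  have "c * 4 \<le> c * k" using k by simp
  hence N: "4 * c \<le> n - 1" using nck r by linarith
  have "p * (1 * (c + 1)) \<le> p * (r * (c + 1))" using r by (intro mult_le_mono) auto
  hence p1: "p * (c + 1) < ?M * n" using p by simp
  consider "c = 2" | "c = 3" | "c \<ge> 4" using c by linarith
  thus ?thesis
  proof cases
    \<comment> \<open>Here \<open>n \<ge> 2 * k + 2\<close> forces \<open>r \<ge> 2\<close>, which
      halves the bound on \<open>p\<close>.\<close>
    case 1
    have "2 \<le> r" using n nck 1 by simp
    hence "p * 2 \<le> p * r" by (intro mult_le_mono) auto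
    moreover have "?M = 3" using 1 by (simp add: eval_nat_numeral)
    moreover from this have "p * r < n" using p 1 by simp
    ultimately have "2 * p < n" by linarith
    thus ?thesis using 1 \<open>?M = 3\<close> n k by simp
  next
    case 2
    have M: "?M = 10" using 2 by (simp add: eval_nat_numeral)
    have n13: "13 \<le> n" using N 2 by simp
    have "2 * ((n - 1) choose 2) = (n - 1) * (n - 2)"
      using binomial_absorption[of 1 "n - 1"] by (simp add: eval_nat_numeral)
    moreover obtain j where j: "n = j + 13" using n13 by (metis add.commute le_Suc_ex)
    moreover have "2 * p < 5 * n" using p1 M 2 by simp
    hence "2 * (p + 10) \<le> 5 * j + 65 + 20" using j by simp
    moreover have "5 * j + 65 + 20 \<le> (j + 12) * (j + 11)" by (simp add: algebra_simps)
    ultimately have "2 * (p + 10) \<le> 2 * ((n - 1) choose 2)"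
      by (simp add: algebra_simps)
    thus ?thesis using M 2 by simp
  next
    case 3
    define N where "N = n - 1"
    have NN: "4 * c \<le> N" "n = N + 1" using N r nck by (auto simp: N_def)
    \<comment> \<open>The factor \<open>N + c + 2\<close> arises on adding \<open>c + 1\<close>
      copies of the central coefficient to \<open>p1\<close>, where
      \<open>n = N + 1\<close>.\<close>
    have "(2 * c - 1) * (N + c + 2) \<le> 2 * c * (2 * N)"
      using NN 3 by (intro mult_le_mono) auto
    also have "\<dots> \<le> (c + 1) * (4 * N)" by simp
    finally have key: "(2 * c - 1) * (N + c + 2) \<le> (c + 1) * (4 * N)" .
    have "(2 * c - 1) * ((c + 1) * (p + ?M)) \<le> (2 * c - 1) * (?M * (N + c + 2))"
      using p1 NN by (intro mult_le_mono2) (simp add: algebra_simps)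
    also have "\<dots> = ?M * ((2 * c - 1) * (N + c + 2))" by (simp only: mult_ac)
    also have "\<dots> \<le> ?M * ((c + 1) * (4 * N))" using key by (intro mult_le_mono2)
    also have "\<dots> = (c + 1) * (4 * N * ?M)" by (simp only: mult_ac)
    also have "\<dots> \<le> (c + 1) * ((2 * c - 1) * (N choose (c - 1)))"
      using binomial_ratio_bound[OF 3 NN(1)] by (intro mult_le_mono2)
    finally have "((2 * c - 1) * (c + 1)) * (p + ?M) \<le> ((2 * c - 1) * (c + 1)) * (N choose (c - 1))"
      by (simp only: mult_ac)
    thus ?thesis using 3 unfolding N_def by simp
  qed
qed

section \<open>The inequality for \<open>SP n k\<close>\<close>

theorem theorem2:
  fixes n k c r :: nat
  assumes "n \<ge> 2 * k + 2" and "k \<ge> 4"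
    and "n = c * k + r" and "r < k"
  shows "real_of_int \<lceil>(1 - real (r * (c + 1)) / real n) * real (SP n k)\<rceil>
         + LL c (real_of_int \<lfloor>real (r * (c + 1)) / real n * real (SP n k)\<rfloor>)
         \<le> real ((n - 1) choose (c - 1))"
proof -
  define p where "p = SP n k"
  define \<rho> where "\<rho> = real (r * (c + 1)) / real n"
  define a where "a = nat \<lfloor>\<rho> * real p\<rfloor>"
  \<comment> \<open>The ceiling equals \<open>p - a\<close> because its argument and that of the
    floor add up to the integer \<open>p\<close>.\<close>
  define b where "b = p - a"
  let ?M = "2 * c - 1 choose c"
  have n0: "n > 0" using assms(1) by linarith
  have c: "c \<ge> 2"
  proof (rule ccontr)
    assume "\<not> ?thesis"
    hence "c * k \<le> 1 * k" by (intro mult_le_mono1) simp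
    thus False using assms by linarith
  qed
  have c1: "c \<ge> 1" using c by simp
  have \<rho>1: "real n * (1 - \<rho>) = real c * (real k - real r)"
  proof -
    have "real n * \<rho> = real (r * (c + 1))" using n0 by (simp add: \<rho>_def)
    moreover have "real n = real c * real k + real r" using assms(3) by simp
    ultimately show ?thesis by (simp add: algebra_simps)
  qed
  have \<rho>: "0 \<le> \<rho>" "\<rho> \<le> 1"
  proof -
    have "0 \<le> real n * (1 - \<rho>)" unfolding \<rho>1 using assms(4) by simp
    thus "\<rho> \<le> 1" using n0 by (simp add: zero_le_mult_iff)
  qed (simp add: \<rho>_def)
  have fl: "real_of_int \<lfloor>\<rho> * real p\<rfloor> = real a" using \<rho> by (simp add: a_def)
  have a: "real a \<le> \<rho> * real p" "\<rho> * real p < real a + 1" using fl by linarith+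
  have "\<rho> * real p \<le> 1 * real p" using \<rho> by (intro mult_right_mono) auto
  hence ap: "a \<le> p" using a by simp
  have "\<lceil>(1 - \<rho>) * real p\<rceil> = int b"
    using a ap by (intro ceiling_unique) (auto simp: b_def algebra_simps)
  hence ce: "real_of_int \<lceil>(1 - \<rho>) * real p\<rceil> = real b" by simp
  have "real b + LL c (real a) \<le> real ((n - 1) choose (c - 1))"
  proof (cases "a = 0 \<or> ?M \<le> a")
    case False
    hence r: "1 \<le> r" using a by (cases r) (auto simp: \<rho>_def)
    have "real a + 1 \<le> real ?M" using False by linarith
    hence "\<rho> * real p < real ?M" using a by linarith
    hence "real p * real (r * (c + 1)) < real ?M * real n"
      using n0 by (simp add: \<rho>_def field_simps)
    hence "p * (r * (c + 1)) < ?M * n" by (simp only: of_nat_mult[symmetric] of_nat_less_iff)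
    hence "p + ?M \<le> (n - 1) choose (c - 1)"
      by (rule few_partitions_bound[OF assms(1-3) r c])
    moreover have "LL c (real a) \<le> real ?M"
      using LL_mono[OF c1, of a ?M] LL_central[OF c1] False by simp
    moreover have "b \<le> p" by (simp add: b_def)
    ultimately show ?thesis by linarith
  next
    case True
    obtain P where P: "sperner_partition_system {..<n} k P" "card P = p"
      using SP_attained[of n k] by (auto simp: p_def)
    obtain x F where F: "x \<in> {..<n}" "antichain F" "F \<subseteq> Pow ({..<n} - {x})" "card F = p"
      "real (k * p) / real n \<le> (\<Sum>A\<in>F. 1 / (real (card A) + 1))"
      using sperner_partition_system_link[OF P(1)] n0 P(2) by auto
    have cX: "card ({..<n} - {x}) = n - 1" using F(1) by simp
    have "c * 4 \<le> c * k" using assms by simp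
    hence N: "3 * c \<le> card ({..<n} - {x})" using cX c assms(3) by linarith
    \<comment> \<open>The affine weight at the average reciprocal sum \<open>k * p / n\<close>: the
      value is \<open>c * ((c + 1) * k - n) * p / n\<close>, and
      \<open>(c + 1) * k - n = k - r\<close>.\<close>
    have "real c * (real c + 1) * (real (k * p) / real n) - real c * p = (1 - \<rho>) * real p"
    proof -
      have "real n * (real c * (real c + 1) * (real (k * p) / real n) - real c * p) =
          real c * ((real c + 1) * k - n) * p"
        using n0 by (simp add: field_simps)
      also have "\<dots> = real n * (1 - \<rho>) * p"
        unfolding \<rho>1 by (simp add: assms(3) algebra_simps)
      finally show ?thesis using n0 by (simp add: mult.assoc)
    qed
    moreover have "(\<Sum>A\<in>F. wt c (card A)) =
        real c * (real c + 1) * (\<Sum>A\<in>F. 1 / (real (card A) + 1)) - real c * p"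
      using F(4) by (simp add: wt_def sum_subtractf sum_distrib_left)
    moreover have "real c * (real c + 1) * (real (k * p) / real n) \<le>
        real c * (real c + 1) * (\<Sum>A\<in>F. 1 / (real (card A) + 1))"
      using F(5) by (intro mult_left_mono) auto
    ultimately have "(1 - \<rho>) * real p \<le> (\<Sum>A\<in>F. wt c (card A))" by linarith
    moreover have "real b < (1 - \<rho>) * real p + 1"
      using a ap by (simp add: b_def algebra_simps)
    ultimately have "real b < (\<Sum>A\<in>F. wt c (card A)) + 1" by linarith
    thus ?thesis
      using antichain_LL_bound[OF c _ N F(2,3), of a b] True ap F(4) cX by (auto simp: b_def)
  qed
  thus ?thesis using fl ce unfolding p_def \<rho>_def by simp
qed

end
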